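(* Let $\mathcal{L}$ be a $d$-dimensional Lie group which is a subgroup of the special unitary group $SU(D)$. Let $\mathcal{G}$ be a finite gate set with cost function $\mathfrak{C}:\mathcal{G}\to\mathbb{R}^+$, such that the group $\langle\mathcal{G}\rangle$ generated by $\mathcal{G}$ satisfies $\langle\mathcal{G}\rangle\subset\mathcal{L}$ and is dense in $\mathcal{L}$. Let $f$ be a real-valued function on $(0,\infty)$ and assume that for every $V\in\mathcal{L}$ and every $\epsilon>0$ there is a finite sequence $W_1,\ldots,W_N\in\mathcal{G}$ whose product $U=W_1W_2\cdots W_N\in\langle\mathcal{G}\rangle$ satisfies $$\|U-V\|\le\epsilon\qquad\text{and}\qquad \sum_{j=1}^N\mathfrak{C}(W_j)\le f(\epsilon).$$ Then for every $V\in\mathcal{L}$ and every $\epsilon$ with $0<\epsilon<0.01$ there exist a finite $n$, unitaries $U_1,\ldots,U_n\in\langle\mathcal{G}\rangle$, each of cost at most $f(\epsilon)$, and probabilities $p_1,\ldots,p_n\ge 0$ with $\sum_{j=1}^n p_j=1$, such that the channel $$\mathcal{E}(\rho)=\sum_{j=1}^n p_j U_j\rho U_j^\dagger$$ satisfies $$d_\diamond(\mathcal{E},\mathcal{V})\le 10\,\epsilon^2,$$ where $\mathcal{V}(\rho)=V\rho V^\dagger$.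
   Context: $\|X\|$ denotes the operator norm (largest singular value) and $\|X\|_1$ the Schatten 1-norm (sum of singular values). For a linear map $\mathcal{E}$ on operators on a finite-dimensional Hilbert space, the diamond norm is $\|\mathcal{E}\|_\diamond:=\sup\{\|(\mathcal{E}\otimes\mathrm{id})(X)\|_1:\|X\|_1\le 1\}$, where $\mathrm{id}$ is the identity map on operators on an auxiliary finite-dimensional Hilbert space (of arbitrary dimension; the dimension of the original space suffices). The diamond distance is $d_\diamond(\mathcal{E},\mathcal{E}'):=\frac12\|\mathcal{E}-\mathcal{E}'\|_\diamond$. A gate set $\mathcal{G}$ is a set of unitaries, and $\langle\mathcal{G}\rangle$ is the group it generates. The cost function $\mathfrak{C}$ takes nonnegative real values (zero-cost gates are allowed). The cost of a sequence $W_1,\ldots,W_N$ of elements of $\mathcal{G}$ is $\sum_{j=1}^N\mathfrak{C}(W_j)$; a unitary $U$ has cost at most $t$ if it can be written as $U=W_1\cdots W_N$ with $W_j\in\mathcal{G}$ and $\sum_j\mathfrak{C}(W_j)\le t$. The assumption on $f$ expresses that there is a unitary synthesis algorithm with worst-case cost $f$. *)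

theory Defs
  imports
    "HOL-Analysis.Analysis"
    "HOL-Algebra.Generated_Groups"
    "Jordan_Normal_Form.Schur_Decomposition"
begin

section \<open>Matrix norms\<close>

text \<open>Singular values, with multiplicity: square roots of the (real, nonnegative) eigenvalues
  of $A^\dagger A$, that is, of the roots of its characteristic polynomial.\<close>

definition singular_values :: "complex mat \<Rightarrow> real multiset" where
  "singular_values A = image_mset (\<lambda>z. sqrt (Re z)) (proots (char_poly (mat_adjoint A * A)))"

text \<open>Meaningful for matrices with at least one column only.\<close>

definition op_norm :: "complex mat \<Rightarrow> real" where
  "op_norm A = Max (set_mset (singular_values A))"

definition trace_norm :: "complex mat \<Rightarrow> real" where
  "trace_norm A = sum_mset (singular_values A)"

section \<open>Diamond norm\<close>

text \<open>Indices of $\mathbb{C}^D \otimes \mathbb{C}^k$ are encoded as \<open>i * k + a\<close> with \<open>i < D\<close>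
  and \<open>a < k\<close>. Writing $X = \sum_{a,b} X_{ab} \otimes |a\rangle\langle b|$, the map
  \<open>E \<otimes> id\<close> replaces every \<open>X\<^sub>a\<^sub>b\<close> by \<open>E X\<^sub>a\<^sub>b\<close>. See \<open>tensor_id_kron\<close> below.\<close>

definition aux_block :: "nat \<Rightarrow> nat \<Rightarrow> complex mat \<Rightarrow> nat \<Rightarrow> nat \<Rightarrow> complex mat" where
  "aux_block D k X a b = mat D D (\<lambda>(i, j). X $$ (i * k + a, j * k + b))"

definition tensor_id ::
    "nat \<Rightarrow> nat \<Rightarrow> (complex mat \<Rightarrow> complex mat) \<Rightarrow> complex mat \<Rightarrow> complex mat" where
  "tensor_id D k E X = mat (D * k) (D * k)
     (\<lambda>(r, s). E (aux_block D k X (r mod k) (s mod k)) $$ (r div k, s div k))"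

text \<open>The set below is bounded whenever \<open>E\<close> is linear on \<open>D\<close>-by-\<open>D\<close> matrices.\<close>

definition diamond_norm :: "nat \<Rightarrow> (complex mat \<Rightarrow> complex mat) \<Rightarrow> real" where
  "diamond_norm D E =
     Sup {trace_norm (tensor_id D k E X) | k X.
            1 \<le> k \<and> X \<in> carrier_mat (D * k) (D * k) \<and> trace_norm X \<le> 1}"

definition diamond_dist ::
    "nat \<Rightarrow> (complex mat \<Rightarrow> complex mat) \<Rightarrow> (complex mat \<Rightarrow> complex mat) \<Rightarrow> real" where
  "diamond_dist D E E' = 1 / 2 * diamond_norm D (\<lambda>\<rho>. E \<rho> - E' \<rho>)"

definition unitary_channel :: "complex mat \<Rightarrow> complex mat \<Rightarrow> complex mat" where
  "unitary_channel V \<rho> = V * \<rho> * mat_adjoint V"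

text \<open>\<open>complex mat\<close> is not an additive monoid type, so the sum over \<open>l\<close> is taken entrywise.\<close>

definition mixed_unitary_channel ::
    "nat \<Rightarrow> nat \<Rightarrow> (nat \<Rightarrow> real) \<Rightarrow> (nat \<Rightarrow> complex mat) \<Rightarrow> complex mat \<Rightarrow> complex mat" where
  "mixed_unitary_channel D n p U \<rho> =
     mat D D (\<lambda>(i, j). \<Sum>l<n. (complex_of_real (p l) \<cdot>\<^sub>m (U l * \<rho> * mat_adjoint (U l))) $$ (i, j))"

definition kron :: "complex mat \<Rightarrow> complex mat \<Rightarrow> complex mat" where
  "kron A B = mat (dim_row A * dim_row B) (dim_col A * dim_col B)
     (\<lambda>(r, s). A $$ (r div dim_row B, s div dim_col B) * B $$ (r mod dim_row B, s mod dim_col B))"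

lemma tensor_id_kron:
  assumes A: "A \<in> carrier_mat D D" and B: "B \<in> carrier_mat k k"
    and E: "\<And>M. M \<in> carrier_mat D D \<Longrightarrow> E M \<in> carrier_mat D D"
    and hom: "\<And>c M. M \<in> carrier_mat D D \<Longrightarrow> E (c \<cdot>\<^sub>m M) = c \<cdot>\<^sub>m E M"
  shows "tensor_id D k E (kron A B) = kron (E A) B"
proof (rule eq_matI)
  have EA: "E A \<in> carrier_mat D D" using E A by blast
  have block: "aux_block D k (kron A B) a b = (B $$ (a, b)) \<cdot>\<^sub>m A" if "a < k" "b < k" for a b
  proof (rule eq_matI)
    fix i j assume "i < dim_row (B $$ (a, b) \<cdot>\<^sub>m A)" "j < dim_col (B $$ (a, b) \<cdot>\<^sub>m A)"
    hence ij: "i < D" "j < D" using A by auto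
    have lt: "i * k + a < D * k" if "i < D" "a < k" for i a
    proof -
      have "i * k + a < Suc i * k" using that by simp
      also have "\<dots> \<le> D * k" using that by (intro mult_le_mono1) simp
      finally show ?thesis .
    qed
    show "aux_block D k (kron A B) a b $$ (i, j) = (B $$ (a, b) \<cdot>\<^sub>m A) $$ (i, j)"
      using A B ij that lt[of i a] lt[of j b]
      by (simp add: aux_block_def kron_def)
  qed (use A in \<open>auto simp: aux_block_def\<close>)
  fix r s assume "r < dim_row (kron (E A) B)" "s < dim_col (kron (E A) B)"
  hence rs: "r < D * k" "s < D * k" using EA B by (auto simp: kron_def)
  hence k: "k > 0" by (cases k) auto
  have div: "r div k < D" "s div k < D" using rs by (simp_all add: less_mult_imp_div_less)
  show "tensor_id D k E (kron A B) $$ (r, s) = kron (E A) B $$ (r, s)"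
    using rs k div A B EA by (simp add: tensor_id_def block hom) (simp add: kron_def)
qed (use E[OF A] B in \<open>auto simp: tensor_id_def kron_def\<close>)

section \<open>Unitary groups, gate sequences and costs\<close>

definition unitary_group :: "nat \<Rightarrow> complex mat monoid" where
  "unitary_group D =
     \<lparr>carrier = {U \<in> carrier_mat D D. mat_adjoint U * U = 1\<^sub>m D \<and> U * mat_adjoint U = 1\<^sub>m D},
      mult = (*), one = 1\<^sub>m D\<rparr>"

definition special_unitary_group :: "nat \<Rightarrow> complex mat monoid" where
  "special_unitary_group D =
     (unitary_group D)\<lparr>carrier := {U \<in> carrier (unitary_group D). det U = 1}\<rparr>"

definition gate_product :: "nat \<Rightarrow> complex mat list \<Rightarrow> complex mat" where
  "gate_product D Ws = foldr (*) Ws (1\<^sub>m D)"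

definition cost_at_most ::
    "nat \<Rightarrow> complex mat set \<Rightarrow> (complex mat \<Rightarrow> real) \<Rightarrow> complex mat \<Rightarrow> real \<Rightarrow> bool" where
  "cost_at_most D \<G> cost U t \<longleftrightarrow>
     (\<exists>Ws. set Ws \<subseteq> \<G> \<and> U = gate_product D Ws \<and> (\<Sum>W\<leftarrow>Ws. cost W) \<le> t)"

section \<open>Smooth manifolds and Lie groups\<close>

text \<open>\<open>F\<close> is of class $C^k$ on the open subset \<open>S\<close> of \<open>Euclidean_space d\<close>: it is continuous and
  its partial derivatives of order up to \<open>k\<close> exist and are continuous.\<close>

primrec Ck_on :: "nat \<Rightarrow> nat \<Rightarrow> (nat \<Rightarrow> real) set \<Rightarrow> ((nat \<Rightarrow> real) \<Rightarrow> real) \<Rightarrow> bool" where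
  "Ck_on d 0 S F \<longleftrightarrow> continuous_map (subtopology (Euclidean_space d) S) euclideanreal F"
| "Ck_on d (Suc k) S F \<longleftrightarrow>
     continuous_map (subtopology (Euclidean_space d) S) euclideanreal F \<and>
     (\<exists>F'. \<forall>i<d. (\<forall>x\<in>S. ((\<lambda>t. F (x(i := t))) has_real_derivative F' i x) (at (x i))) \<and>
                   Ck_on d k S (F' i))"

definition smooth_on :: "nat \<Rightarrow> (nat \<Rightarrow> real) set \<Rightarrow> ((nat \<Rightarrow> real) \<Rightarrow> real) \<Rightarrow> bool" where
  "smooth_on d S F \<longleftrightarrow> (\<forall>k. Ck_on d k S F)"

type_synonym 'a chart = "'a set \<times> ('a \<Rightarrow> nat \<Rightarrow> real)"

definition is_chart :: "nat \<Rightarrow> 'a topology \<Rightarrow> 'a chart \<Rightarrow> bool" where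
  "is_chart d X c \<longleftrightarrow>
     (case c of (U, \<phi>) \<Rightarrow>
        openin X U \<and> openin (Euclidean_space d) (\<phi> ` U) \<and>
        homeomorphic_map (subtopology X U) (subtopology (Euclidean_space d) (\<phi> ` U)) \<phi>)"

definition smooth_manifold :: "nat \<Rightarrow> 'a topology \<Rightarrow> 'a chart set \<Rightarrow> bool" where
  "smooth_manifold d X A \<longleftrightarrow>
     Hausdorff_space X \<and> second_countable X \<and>
     (\<forall>c\<in>A. is_chart d X c) \<and> (\<Union>(U, \<phi>)\<in>A. U) = topspace X \<and>
     (\<forall>(U, \<phi>)\<in>A. \<forall>(W, \<psi>)\<in>A. \<forall>j<d.
        smooth_on d (\<phi> ` (U \<inter> W)) (\<lambda>x. \<psi> (inv_into U \<phi> x) j))"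

definition smooth_map ::
    "nat \<Rightarrow> 'a topology \<Rightarrow> 'a chart set \<Rightarrow> nat \<Rightarrow> 'b topology \<Rightarrow> 'b chart set \<Rightarrow> ('a \<Rightarrow> 'b) \<Rightarrow> bool"
  where
  "smooth_map d X A e Y B h \<longleftrightarrow>
     continuous_map X Y h \<and>
     (\<forall>(U, \<phi>)\<in>A. \<forall>(W, \<psi>)\<in>B. \<forall>j<e.
        smooth_on d (\<phi> ` (U \<inter> h -` W)) (\<lambda>x. \<psi> (h (inv_into U \<phi> x)) j))"

text \<open>Charts of a product take values in $\mathbb{R}^{d} \times \mathbb{R}^{e} = \mathbb{R}^{d+e}$,
  the first \<open>d\<close> coordinates coming from the first factor.\<close>

definition prod_atlas :: "nat \<Rightarrow> 'a chart set \<Rightarrow> 'b chart set \<Rightarrow> ('a \<times> 'b) chart set" where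
  "prod_atlas d A B =
     {(U \<times> W, \<lambda>(x, y) i. if i < d then \<phi> x i else \<psi> y (i - d)) | U \<phi> W \<psi>.
        (U, \<phi>) \<in> A \<and> (W, \<psi>) \<in> B}"

definition lie_group :: "nat \<Rightarrow> 'a monoid \<Rightarrow> 'a topology \<Rightarrow> 'a chart set \<Rightarrow> bool" where
  "lie_group d G X A \<longleftrightarrow>
     group G \<and> smooth_manifold d X A \<and> topspace X = carrier G \<and>
     smooth_map (d + d) (prod_topology X X) (prod_atlas d A A) d X A (\<lambda>(x, y). x \<otimes>\<^bsub>G\<^esub> y) \<and>
     smooth_map d X A d X A (\<lambda>x. inv\<^bsub>G\<^esub> x)"

text \<open>A Lie subgroup in the general sense: the Lie group \<open>L\<close> carries its own manifold structure,
  whose topology may be finer than the subspace topology (\<open>L\<close> need not be closed), and the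
  inclusion into the \<open>D\<close>-by-\<open>D\<close> matrices is smooth. An injective smooth homomorphism of Lie
  groups is automatically an immersion.\<close>

definition lie_subgroup_SU :: "nat \<Rightarrow> nat \<Rightarrow> complex mat set \<Rightarrow> bool" where
  "lie_subgroup_SU d D L \<longleftrightarrow>
     subgroup L (special_unitary_group D) \<and>
     (\<exists>X A. lie_group d ((special_unitary_group D)\<lparr>carrier := L\<rparr>) X A \<and>
        (\<forall>(U, \<phi>)\<in>A. \<forall>i<D. \<forall>j<D.
           smooth_on d (\<phi> ` U) (\<lambda>x. Re (inv_into U \<phi> x $$ (i, j))) \<and>
           smooth_on d (\<phi> ` U) (\<lambda>x. Im (inv_into U \<phi> x $$ (i, j)))))"

end

theory Submission
  imports Defs
begin

text \<open>Let \<open>\<phi>\<close> choose for each \<open>W \<in> L\<close> a cheap word within \<open>\<epsilon>\<close> of \<open>W\<close>. Start from \<open>v\<^sub>0 = V\<close> and let each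
  target overcompensate the previous error: with \<open>g\<^sub>l = v\<^sub>l\<^sup>\<dagger> \<phi>(v\<^sub>l)\<close> put \<open>v\<^sub>l\<^sub>+\<^sub>1 = V g\<^sub>l\<^sup>\<dagger>\<close>, so that
  \<open>\<phi>(v\<^sub>l\<^sub>+\<^sub>1) = V g\<^sub>l\<^sup>\<dagger> g\<^sub>l\<^sub>+\<^sub>1\<close>. To first order the error is \<open>V (g\<^sub>l\<^sub>+\<^sub>1 - g\<^sub>l)\<close>, which telescopes. Hence the
  uniform mixture of \<open>n \<ge> 1 / \<epsilon>\<close> of these words has mean within \<open>4 \<epsilon>\<^sup>2\<close> of \<open>V\<close>, while every word
  is within \<open>2 \<epsilon>\<close> of \<open>V\<close>. A mixture with mean within \<open>m\<close> and members within \<open>\<delta>\<close> of \<open>V\<close> has diamond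
  distance at most \<open>m + \<delta>\<^sup>2 / 2\<close>, here \<open>6 \<epsilon>\<^sup>2\<close>.\<close>

unbundle no vec_syntax

section \<open>Adjoints, norms and unitary matrices\<close>

lemma mult_mat_index:
  assumes "A \<in> carrier_mat n m" "B \<in> carrier_mat m p" "i < n" "j < p"
  shows "(A * B) $$ (i, j) = (\<Sum>k<m. A $$ (i, k) * B $$ (k, j))"
  using assms by (simp add: scalar_prod_def atLeast0LessThan)

lemma mult_mat_vec_index:
  assumes "A \<in> carrier_mat n m" "v \<in> carrier_vec m" "i < n"
  shows "(A *\<^sub>v v) $ i = (\<Sum>k<m. A $$ (i, k) * v $ k)"
  using assms by (simp add: scalar_prod_def atLeast0LessThan)

lemma mat_adjoint_dim [simp]:
  "dim_row (mat_adjoint A) = dim_col A" "dim_col (mat_adjoint A) = dim_row A"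
  by (simp_all add: mat_adjoint_def)

lemma mat_adjoint_carrier [simp, intro]:
  "A \<in> carrier_mat n m \<Longrightarrow> mat_adjoint A \<in> carrier_mat m n"
  by (auto simp: mat_adjoint_def)

lemma mat_adjoint_index:
  assumes "A \<in> carrier_mat n m" "i < m" "j < n"
  shows "mat_adjoint A $$ (i, j) = conjugate (A $$ (j, i))"
  using assms by (simp add: mat_adjoint_def mat_of_rows_def)

lemma mat_adjoint_adjoint [simp]: "mat_adjoint (mat_adjoint A) = A"
proof -
  have A: "A \<in> carrier_mat (dim_row A) (dim_col A)" by auto
  note A' = mat_adjoint_carrier[OF A]
  show ?thesis
    using carrier_matD[OF mat_adjoint_carrier[OF A']]
    by (intro eq_matI) (simp_all add: mat_adjoint_index[OF A'] mat_adjoint_index[OF A])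
qed

lemma mat_adjoint_mult:
  fixes A B :: "complex mat"
  assumes A: "A \<in> carrier_mat n m" and B: "B \<in> carrier_mat m p"
  shows "mat_adjoint (A * B) = mat_adjoint B * mat_adjoint A"
proof -
  have AB: "A * B \<in> carrier_mat n p" using A B by auto
  note c = mat_adjoint_carrier[OF A] mat_adjoint_carrier[OF B]
  show ?thesis
  proof (rule eq_matI)
    fix i j assume "i < dim_row (mat_adjoint B * mat_adjoint A)"
      "j < dim_col (mat_adjoint B * mat_adjoint A)"
    hence ij: "i < p" "j < n" using c by auto
    show "mat_adjoint (A * B) $$ (i, j) = (mat_adjoint B * mat_adjoint A) $$ (i, j)"
      unfolding mult_mat_index[OF c(2,1) ij] mat_adjoint_index[OF AB ij]
        mult_mat_index[OF A B ij(2,1)]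
      using ij by (auto simp: mat_adjoint_index[OF A] mat_adjoint_index[OF B] intro!: sum.cong)
  qed (use carrier_matD[OF mat_adjoint_carrier[OF AB]] c in auto)
qed

lemma mat_adjoint_minus:
  fixes A B :: "complex mat"
  assumes A: "A \<in> carrier_mat n m" and B: "B \<in> carrier_mat n m"
  shows "mat_adjoint (A - B) = mat_adjoint A - mat_adjoint B"
  using assms
  by (intro eq_matI) (auto simp: mat_adjoint_index[OF A] mat_adjoint_index[OF B]
      mat_adjoint_index[OF minus_carrier_mat[OF B]])

lemma mat_adjoint_one [simp]: "mat_adjoint (1\<^sub>m n :: complex mat) = 1\<^sub>m n"
  by (rule eq_matI) (auto simp: mat_adjoint_index[OF one_carrier_mat])

section \<open>Euclidean norm and Hermitian inner product of complex vectors\<close>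

definition vec_norm2 :: "complex vec \<Rightarrow> real" where
  "vec_norm2 v = L2_set (\<lambda>i. cmod (v $ i)) {..<dim_vec v}"

lemma vec_norm2_nonneg [simp]: "0 \<le> vec_norm2 v"
  by (simp add: vec_norm2_def)

lemma vec_norm2_sq:
  "v \<in> carrier_vec n \<Longrightarrow> (vec_norm2 v)\<^sup>2 = (\<Sum>i<n. (cmod (v $ i))\<^sup>2)"
  unfolding vec_norm2_def L2_set_def by (simp add: sum_nonneg)

lemma vec_norm2_triangle:
  assumes "v \<in> carrier_vec n" "w \<in> carrier_vec n"
  shows "vec_norm2 (v + w) \<le> vec_norm2 v + vec_norm2 w"
proof -
  have "vec_norm2 (v + w) \<le> L2_set (\<lambda>i. cmod (v $ i) + cmod (w $ i)) {..<n}"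
    unfolding vec_norm2_def using assms
    by (auto intro!: L2_set_mono norm_triangle_ineq)
  also have "\<dots> \<le> vec_norm2 v + vec_norm2 w"
    unfolding vec_norm2_def using assms by (simp add: L2_set_triangle_ineq)
  finally show ?thesis .
qed

lemma vec_norm2_smult: "vec_norm2 (c \<cdot>\<^sub>v v) = cmod c * vec_norm2 v"
  unfolding vec_norm2_def L2_set_right_distrib[OF norm_ge_zero]
  by (intro L2_set_cong) (auto simp: norm_mult)

lemma norm_index_le_vec_norm2: "i < dim_vec v \<Longrightarrow> cmod (v $ i) \<le> vec_norm2 v"
  unfolding vec_norm2_def by (intro member_le_L2_set) auto

text \<open>The conjugate sits on the first argument, so that entry \<open>(i, j)\<close> of
  \<open>mat_adjoint A * B\<close> is the inner product of column \<open>i\<close> of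
  \<open>A\<close> with column \<open>j\<close> of \<open>B\<close>, in this order.\<close>

definition cinner :: "complex vec \<Rightarrow> complex vec \<Rightarrow> complex" where
  "cinner v w = (\<Sum>i<dim_vec w. cnj (v $ i) * w $ i)"

lemma cinner_self: "cinner v v = of_real ((vec_norm2 v)\<^sup>2)"
proof -
  have "cinner v v = (\<Sum>i<dim_vec v. complex_of_real ((cmod (v $ i))\<^sup>2))"
    unfolding cinner_def
    by (intro sum.cong refl) (metis complex_norm_square mult.commute of_real_power)
  also have "\<dots> = of_real ((vec_norm2 v)\<^sup>2)"
    by (simp add: vec_norm2_sq[of v "dim_vec v"])
  finally show ?thesis .
qed

text \<open>Cauchy-Schwarz, reduced by the triangle inequality to its real version for the moduli of
  the entries.\<close>

lemma cinner_le:
  assumes "v \<in> carrier_vec n" "w \<in> carrier_vec n"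
  shows "cmod (cinner v w) \<le> vec_norm2 v * vec_norm2 w"
proof -
  have "cmod (cinner v w) \<le> (\<Sum>i<n. \<bar>cmod (v $ i)\<bar> * \<bar>cmod (w $ i)\<bar>)"
    unfolding cinner_def using assms
    by (intro order_trans[OF norm_sum]) (auto simp: norm_mult)
  also have "\<dots> \<le> vec_norm2 v * vec_norm2 w"
    using assms L2_set_mult_ineq[of "\<lambda>i. cmod (v $ i)" "\<lambda>i. cmod (w $ i)"]
    by (auto simp: vec_norm2_def)
  finally show ?thesis .
qed

lemma cinner_adjoint:
  assumes A: "A \<in> carrier_mat n m" and v: "v \<in> carrier_vec n" and w: "w \<in> carrier_vec m"
  shows "cinner v (A *\<^sub>v w) = cinner (mat_adjoint A *\<^sub>v v) w"
proof -
  have "cinner v (A *\<^sub>v w) = (\<Sum>i<n. \<Sum>j<m. cnj (v $ i) * (A $$ (i, j) * w $ j))"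
    unfolding cinner_def using A by (simp add: mult_mat_vec_index[OF A w] sum_distrib_left del: index_mult_mat_vec)
  also have "\<dots> = (\<Sum>j<m. \<Sum>i<n. cnj (v $ i) * (A $$ (i, j) * w $ j))"
    by (rule sum.swap)
  also have "\<dots> = cinner (mat_adjoint A *\<^sub>v v) w"
    unfolding cinner_def using w
    by (auto simp: mult_mat_vec_index[OF mat_adjoint_carrier[OF A] v] sum_distrib_left
        mat_adjoint_index[OF A] mult_ac simp del: index_mult_mat_vec intro!: sum.cong)
  finally show ?thesis .
qed

text \<open>Moving \<open>A\<close> across the inner product shows that lengths of images depend on
  \<open>A\<close> only through its Gram matrix. This makes unitaries isometric and gives explicit
  lengths when the Gram matrix is diagonal.\<close>

lemma mult_mat_vec_norm2:
  assumes A: "A \<in> carrier_mat n m" and v: "v \<in> carrier_vec m"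
  shows "of_real ((vec_norm2 (A *\<^sub>v v))\<^sup>2) = cinner v ((mat_adjoint A * A) *\<^sub>v v)"
proof -
  have Av: "A *\<^sub>v v \<in> carrier_vec n" using A v by auto
  show ?thesis
    unfolding cinner_self[symmetric] assoc_mult_mat_vec[OF mat_adjoint_carrier[OF A] A v]
    using cinner_adjoint[OF mat_adjoint_carrier[OF A] v Av] by simp
qed

section \<open>Unitary matrices\<close>

definition unitary_mat :: "nat \<Rightarrow> complex mat \<Rightarrow> bool" where
  "unitary_mat n U \<longleftrightarrow>
     U \<in> carrier_mat n n \<and> mat_adjoint U * U = 1\<^sub>m n \<and> U * mat_adjoint U = 1\<^sub>m n"

lemma unitary_matD:
  assumes "unitary_mat n U"
  shows "U \<in> carrier_mat n n" "mat_adjoint U * U = 1\<^sub>m n" "U * mat_adjoint U = 1\<^sub>m n"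
  using assms by (auto simp: unitary_mat_def)

text \<open>A left inverse of a square matrix is also a right inverse, so one identity
  suffices.\<close>

lemma unitary_matI:
  assumes U: "U \<in> carrier_mat n n" and "mat_adjoint U * U = 1\<^sub>m n"
  shows "unitary_mat n U"
  using assms mat_mult_left_right_inverse[OF mat_adjoint_carrier[OF U] U]
  by (auto simp: unitary_mat_def)

lemma unitary_mat_adjoint: "unitary_mat n U \<Longrightarrow> unitary_mat n (mat_adjoint U)"
  by (auto simp: unitary_mat_def)

lemma unitary_mat_mult:
  assumes U: "unitary_mat n U" and V: "unitary_mat n V"
  shows "unitary_mat n (U * V)"
proof (rule unitary_matI)
  note c = unitary_matD(1)[OF U] unitary_matD(1)[OF V]
  note a = c[THEN mat_adjoint_carrier]
  show UV: "U * V \<in> carrier_mat n n" using c by auto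
  have "mat_adjoint (U * V) * (U * V) = mat_adjoint V * (mat_adjoint U * (U * V))"
    unfolding mat_adjoint_mult[OF c] by (rule assoc_mult_mat[OF a(2,1) UV])
  also have "mat_adjoint U * (U * V) = V"
    unfolding assoc_mult_mat[OF a(1) c, symmetric] unitary_matD(2)[OF U] using c by auto
  finally show "mat_adjoint (U * V) * (U * V) = 1\<^sub>m n" using unitary_matD(2)[OF V] by simp
qed

lemma unitary_mat_vec_norm2:
  assumes U: "unitary_mat n U" and v: "v \<in> carrier_vec n"
  shows "vec_norm2 (U *\<^sub>v v) = vec_norm2 v"
proof -
  have "complex_of_real ((vec_norm2 (U *\<^sub>v v))\<^sup>2) = of_real ((vec_norm2 v)\<^sup>2)"
    unfolding mult_mat_vec_norm2[OF unitary_matD(1)[OF U] v] unitary_matD(2)[OF U]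
    using v by (simp add: cinner_self)
  thus ?thesis by (simp del: of_real_power)
qed

section \<open>Unitary diagonalisation of Hermitian matrices\<close>

lemma mat_adjoint_mult_index:
  assumes A: "A \<in> carrier_mat n m" and B: "B \<in> carrier_mat n p" and "i < m" "j < p"
  shows "(mat_adjoint A * B) $$ (i, j) = cinner (col A i) (col B j)"
  using assms mult_mat_index[OF mat_adjoint_carrier[OF A] B assms(3,4)]
  by (simp add: cinner_def mat_adjoint_index[OF A])

text \<open>Complete \<open>v\<close> to a basis, apply Gram-Schmidt, which keeps the first vector,
  and normalise; the scalar \<open>c\<close> accounts for the normalisation.\<close>

lemma unitary_mat_first_col:
  assumes v: "v \<in> carrier_vec n" and nv: "v \<noteq> 0\<^sub>v n"
  shows "\<exists>W c. unitary_mat n W \<and> c \<noteq> 0 \<and> col W 0 = c \<cdot>\<^sub>v v"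
proof -
  interpret cof_vec_space n "TYPE(complex)" .
  define b where "b = basis_completion v"
  from basis_completion[OF v nv, folded b_def]
  have dist_b: "distinct b" and indep: "\<not> lin_dep (set b)" and b: "set b \<subseteq> carrier_vec n"
    and hdb: "hd b = v" and len_b: "length b = n" by auto
  have n: "n > 0" using v nv by (cases n) auto
  then obtain vs where bv: "b = v # vs" using hdb len_b by (cases b) auto
  define ws where "ws = gram_schmidt n b"
  from gram_schmidt_result[OF b dist_b indep refl, folded ws_def]
  have ws: "set ws \<subseteq> carrier_vec n" "corthogonal ws" "length ws = n" by (auto simp: len_b)
  from gram_schmidt_hd[OF v, of vs, folded bv] have hdws: "hd ws = v" unfolding ws_def .
  have wsc: "ws ! i \<in> carrier_vec n" if "i < n" for i using ws that by auto
  have inner: "cinner (ws ! i) (ws ! j) = conjugate (ws ! i) \<bullet> (ws ! j)" if "i < n" "j < n" for i j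
    using wsc[OF that(1)] wsc[OF that(2)] by (simp add: cinner_def scalar_prod_def atLeast0LessThan)
  \<comment> \<open>\<open>corthogonal\<close> is an equivalence: the case \<open>i = j\<close> says
    that no vector vanishes, which permits the normalisation below. It conjugates the second vector,
    hence the order \<open>j i\<close>.\<close>
  have orth: "cinner (ws ! i) (ws ! j) = 0 \<longleftrightarrow> i \<noteq> j" if "i < n" "j < n" for i j
    unfolding inner[OF that] using corthogonalD[OF ws(2), of j i] that ws(3)
    conjugate_vec_sprod_comm[OF wsc[OF that(2)] wsc[OF that(1)]] by auto
  define c where "c i = complex_of_real (1 / vec_norm2 (ws ! i))" for i
  have pos: "vec_norm2 (ws ! i) \<noteq> 0" if "i < n" for i
    using orth[OF that that] by (auto simp: cinner_self)
  define W where "W = mat_of_cols n (map (\<lambda>i. c i \<cdot>\<^sub>v ws ! i) [0..<n])"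
  have W: "W \<in> carrier_mat n n" unfolding W_def by auto
  have colW: "col W i = c i \<cdot>\<^sub>v ws ! i" if "i < n" for i
    unfolding W_def using that wsc[OF that] by (subst col_mat_of_cols) auto
  have "mat_adjoint W * W = 1\<^sub>m n"
  proof (rule eq_matI)
    fix i j assume "i < dim_row (1\<^sub>m n :: complex mat)" "j < dim_col (1\<^sub>m n :: complex mat)"
    hence ij: "i < n" "j < n" by auto
    have "(mat_adjoint W * W) $$ (i, j) = cnj (c i) * c j * cinner (ws ! i) (ws ! j)"
      unfolding mat_adjoint_mult_index[OF W W ij] colW[OF ij(1)] colW[OF ij(2)] cinner_def
      using wsc[OF ij(1)] wsc[OF ij(2)]
      by (auto simp: sum_distrib_left mult_ac intro!: sum.cong)
    also have "\<dots> = 1\<^sub>m n $$ (i, j)"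
      using ij orth[OF ij] pos[OF ij(1)]
      by (cases "i = j") (auto simp: cinner_self c_def power2_eq_square)
    finally show "(mat_adjoint W * W) $$ (i, j) = 1\<^sub>m n $$ (i, j)" .
  qed (use W in simp_all)
  hence "unitary_mat n W" by (rule unitary_matI[OF W])
  moreover have "ws ! 0 = v" using hdws ws(3) n by (cases ws) auto
  hence "col W 0 = c 0 \<cdot>\<^sub>v v" using colW[OF n] by simp
  moreover have "c 0 \<noteq> 0" using pos[OF n] by (simp add: c_def)
  ultimately show ?thesis by blast
qed

lemma eigenvector_exists:
  fixes A :: "complex mat"
  assumes A: "A \<in> carrier_mat n n" and n: "n > 0"
  obtains v e where "v \<in> carrier_vec n" "v \<noteq> 0\<^sub>v n" "A *\<^sub>v v = e \<cdot>\<^sub>v v"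
proof -
  have "degree (char_poly A) = n" using degree_monic_char_poly[OF A] by simp
  hence "\<not> constant (poly (char_poly A))" using n by (simp add: constant_degree)
  then obtain e where "poly (char_poly A) e = 0"
    using fundamental_theorem_of_algebra by blast
  hence "eigenvalue A e" using eigenvalue_root_char_poly[OF A] by simp
  thus ?thesis using that A unfolding eigenvalue_def eigenvector_def by auto
qed

lemma four_block_mat_adjoint:
  fixes A :: "complex mat"
  assumes c: "A \<in> carrier_mat n n" "B \<in> carrier_mat n m" "C \<in> carrier_mat m n" "D \<in> carrier_mat m m"
  shows "mat_adjoint (four_block_mat A B C D) =
    four_block_mat (mat_adjoint A) (mat_adjoint C) (mat_adjoint B) (mat_adjoint D)"
proof -
  have F: "four_block_mat A B C D \<in> carrier_mat (n + m) (n + m)" using c by auto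
  note a = c[THEN mat_adjoint_carrier]
  show ?thesis
    by (rule eq_matI) (use c carrier_matD[OF F] in
        \<open>auto simp: mat_adjoint_index[OF F] mat_adjoint_index[OF c(1)] mat_adjoint_index[OF c(2)]
          mat_adjoint_index[OF c(3)] mat_adjoint_index[OF c(4)]\<close>)
qed

definition diagonal_of :: "nat \<Rightarrow> (nat \<Rightarrow> complex) \<Rightarrow> complex mat" where
  "diagonal_of n g = mat n n (\<lambda>(i, j). if i = j then g i else 0)"

lemma diagonal_of_carrier [simp]: "diagonal_of n g \<in> carrier_mat n n"
  by (simp add: diagonal_of_def)

lemma mult_block_diagonal:
  assumes A: "A \<in> carrier_mat n n" "A' \<in> carrier_mat n n"
    and D: "D \<in> carrier_mat m m" "D' \<in> carrier_mat m m"
  shows "four_block_mat A (0\<^sub>m n m) (0\<^sub>m m n) D * four_block_mat A' (0\<^sub>m n m) (0\<^sub>m m n) D' =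
    four_block_mat (A * A') (0\<^sub>m n m) (0\<^sub>m m n) (D * D')"
proof -
  have z: "0\<^sub>m n m \<in> carrier_mat n m" "0\<^sub>m m n \<in> carrier_mat m n" by auto
  show ?thesis
    unfolding mult_four_block_mat[OF A(1) z D(1) A(2) z D(2)]
    using assms by simp
qed

text \<open>Spectral theorem by induction on the dimension: a unitary whose first column is an
  eigenvector splits off a 1-by-1 block, and the remaining block is again Hermitian.\<close>

lemma hermitian_unitary_diagonalisation:
  assumes "A \<in> carrier_mat n n" "mat_adjoint A = A"
  shows "\<exists>P g. unitary_mat n P \<and> mat_adjoint P * A * P = diagonal_of n g"
  using assms
proof (induction n arbitrary: A)
  case 0
  have "unitary_mat 0 (1\<^sub>m 0)" by (rule unitary_matI) auto
  moreover have "mat_adjoint (1\<^sub>m 0) * A * 1\<^sub>m 0 = diagonal_of 0 (\<lambda>_. 0)"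
    using 0 by (intro eq_matI) (auto simp: diagonal_of_def)
  ultimately show ?case by blast
next
  case (Suc n)
  note A = Suc.prems(1)
  obtain v e where v: "v \<in> carrier_vec (Suc n)" "v \<noteq> 0\<^sub>v (Suc n)" and ev: "A *\<^sub>v v = e \<cdot>\<^sub>v v"
    using eigenvector_exists[OF A] by blast
  obtain W c where uW: "unitary_mat (Suc n) W" and W0: "col W 0 = c \<cdot>\<^sub>v v"
    using unitary_mat_first_col[OF v] by blast
  note W = unitary_matD(1)[OF uW]
  note W' = mat_adjoint_carrier[OF W]
  define B where "B = mat_adjoint W * (A * W)"
  have AW: "A * W \<in> carrier_mat (Suc n) (Suc n)" using A W by auto
  have B: "B \<in> carrier_mat (Suc n) (Suc n)" unfolding B_def using AW W' by auto
  have Bh: "mat_adjoint B = B"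
    unfolding B_def mat_adjoint_mult[OF W' AW] mat_adjoint_mult[OF A W] Suc.prems(2)
    using assoc_mult_mat[OF W' A W] by simp
  have Bsym: "B $$ (i, j) = cnj (B $$ (j, i))" if "i < Suc n" "j < Suc n" for i j
    using mat_adjoint_index[OF B that] Bh by simp
  have col0: "col (A * W) 0 = e \<cdot>\<^sub>v col W 0"
  proof -
    have "col (A * W) 0 = A *\<^sub>v col W 0" using A W by auto
    also have "\<dots> = e \<cdot>\<^sub>v col W 0"
      unfolding W0 using mult_mat_vec[OF A v(1)] ev by (simp add: smult_smult_assoc mult.commute)
    finally show ?thesis .
  qed
  \<comment> \<open>Column 0 of \<open>W\<close> is an eigenvector of \<open>A\<close> and is
    orthogonal to the other columns of \<open>W\<close>.\<close>
  have B0: "B $$ (i, 0) = (if i = 0 then e else 0)" if "i < Suc n" for i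
  proof -
    have "B $$ (i, 0) = cinner (col W i) (e \<cdot>\<^sub>v col W 0)"
      unfolding B_def using mat_adjoint_mult_index[OF W AW that] col0 by simp
    also have "\<dots> = e * cinner (col W i) (col W 0)"
      unfolding cinner_def sum_distrib_left using W by (intro sum.cong) auto
    also have "cinner (col W i) (col W 0) = 1\<^sub>m (Suc n) $$ (i, 0)"
      using mat_adjoint_mult_index[OF W W that, of 0] unitary_matD(2)[OF uW] by simp
    finally show ?thesis using that by simp
  qed
  define B' where "B' = mat n n (\<lambda>(i, j). B $$ (Suc i, Suc j))"
  have B'c: "B' \<in> carrier_mat n n" by (simp add: B'_def)
  have "mat_adjoint B' = B'"
  proof (rule eq_matI)
    fix i j assume "i < dim_row B'" "j < dim_col B'"
    hence ij: "i < n" "j < n" by (auto simp: B'_def)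
    have "mat_adjoint B' $$ (i, j) = cnj (B $$ (Suc j, Suc i))"
      using mat_adjoint_index[OF B'c ij] ij by (simp add: B'_def)
    also have "\<dots> = B' $$ (i, j)" using ij Bsym[of "Suc i" "Suc j"] by (simp add: B'_def)
    finally show "mat_adjoint B' $$ (i, j) = B' $$ (i, j)" .
  qed (use B'c in auto)
  from Suc.IH[OF B'c this] obtain P g where uP: "unitary_mat n P"
    and Pg: "mat_adjoint P * B' * P = diagonal_of n g" by blast
  note P = unitary_matD(1)[OF uP]
  note P' = mat_adjoint_carrier[OF P]
  let ?e = "mat 1 1 (\<lambda>_. e)"
  have e: "?e \<in> carrier_mat 1 1" by simp
  \<comment> \<open>Hermitian symmetry carries the zeros of the first column over to the first
    row.\<close>
  have Bblock: "B = four_block_mat ?e (0\<^sub>m 1 n) (0\<^sub>m n 1) B'"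
  proof (rule eq_matI)
    fix i j assume "i < dim_row (four_block_mat ?e (0\<^sub>m 1 n) (0\<^sub>m n 1) B')"
      "j < dim_col (four_block_mat ?e (0\<^sub>m 1 n) (0\<^sub>m n 1) B')"
    hence ij: "i < Suc n" "j < Suc n" by (auto simp: B'_def)
    show "B $$ (i, j) = four_block_mat ?e (0\<^sub>m 1 n) (0\<^sub>m n 1) B' $$ (i, j)"
      using ij B0[OF ij(1)] B0[OF ij(2)] Bsym[of 0 j]
      by (cases i; cases j) (auto simp: B'_def)
  qed (use B B'c in auto)
  \<comment> \<open>\<open>F\<close> fixes the eigenvector already split off and acts as
    \<open>P\<close> on the complement, so \<open>W * F\<close> is the unitary sought.\<close>
  define F where "F = four_block_mat (1\<^sub>m 1) (0\<^sub>m 1 n) (0\<^sub>m n 1) P"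
  have F: "F \<in> carrier_mat (Suc n) (Suc n)" unfolding F_def using P by auto
  note F' = mat_adjoint_carrier[OF F]
  have adj0: "mat_adjoint (0\<^sub>m k l :: complex mat) = 0\<^sub>m l k" for k l
    by (rule eq_matI) (auto simp: mat_adjoint_index[OF zero_carrier_mat])
  have F_adj: "mat_adjoint F = four_block_mat (1\<^sub>m 1) (0\<^sub>m 1 n) (0\<^sub>m n 1) (mat_adjoint P)"
    unfolding F_def by (subst four_block_mat_adjoint[of _ 1 _ n]) (use P in \<open>auto simp: adj0\<close>)
  have "mat_adjoint F * F = four_block_mat (1\<^sub>m 1) (0\<^sub>m 1 n) (0\<^sub>m n 1) (mat_adjoint P * P)"
    unfolding F_adj unfolding F_def using mult_block_diagonal[OF one_carrier_mat one_carrier_mat P' P]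
    by simp
  also have "\<dots> = 1\<^sub>m (Suc n)" unfolding unitary_matD(2)[OF uP] by (simp add: four_block_one_mat)
  finally have uF: "unitary_mat (Suc n) F" by (rule unitary_matI[OF F])
  have "mat_adjoint (W * F) * A * (W * F) = mat_adjoint F * B * F"
  proof -
    have WF: "W * F \<in> carrier_mat (Suc n) (Suc n)" using W F by auto
    have "mat_adjoint (W * F) * A * (W * F) = mat_adjoint F * mat_adjoint W * (A * (W * F))"
      unfolding mat_adjoint_mult[OF W F]
      by (rule assoc_mult_mat[of _ "Suc n" "Suc n" _ "Suc n" _ "Suc n"]) (use F' W' A WF in auto)
    also have "A * (W * F) = A * W * F" using assoc_mult_mat[OF A W F] by simp
    also have "mat_adjoint F * mat_adjoint W * (A * W * F) = mat_adjoint F * (mat_adjoint W * (A * W * F))"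
      by (rule assoc_mult_mat[of _ "Suc n" "Suc n" _ "Suc n" _ "Suc n"]) (use F' W' AW F in auto)
    also have "mat_adjoint W * (A * W * F) = B * F"
      unfolding B_def using assoc_mult_mat[OF W' AW F] by simp
    also have "mat_adjoint F * (B * F) = mat_adjoint F * B * F"
      using assoc_mult_mat[OF F' B F] by simp
    finally show ?thesis .
  qed
  also have "mat_adjoint F * B = four_block_mat ?e (0\<^sub>m 1 n) (0\<^sub>m n 1) (mat_adjoint P * B')"
    unfolding F_adj Bblock mult_block_diagonal[OF one_carrier_mat e P' B'c] left_mult_one_mat[OF e] ..
  also have "\<dots> * F = four_block_mat ?e (0\<^sub>m 1 n) (0\<^sub>m n 1) (mat_adjoint P * B' * P)"
    unfolding F_def mult_block_diagonal[OF e one_carrier_mat mult_carrier_mat[OF P' B'c] P]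
      right_mult_one_mat[OF e] ..
  also have "\<dots> = diagonal_of (Suc n) (\<lambda>i. if i = 0 then e else g (i - 1))"
    unfolding Pg by (rule eq_matI) (auto simp: diagonal_of_def)
  finally show ?case using unitary_mat_mult[OF uW uF] by blast
qed

section \<open>Singular values\<close>

lemma proots_char_poly_diagonal_of:
  "proots (char_poly (diagonal_of n g)) = mset (map g [0..<n])"
proof -
  have ut: "upper_triangular (diagonal_of n g)"
    unfolding upper_triangular_def by (auto simp: diagonal_of_def)
  have diag: "diag_mat (diagonal_of n g) = map g [0..<n]"
    by (auto simp: diag_mat_def diagonal_of_def)
  have "proots (\<Prod>a\<leftarrow>xs. [:- a, 1:]) = mset xs" for xs :: "complex list"
  proof (induction xs)
    case (Cons a xs)
    have "(\<Prod>a\<leftarrow>xs. [:- a, 1:]) \<noteq> 0" by (auto simp: prod_list_zero_iff)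
    hence "proots ([:- a, 1:] * (\<Prod>a\<leftarrow>xs. [:- a, 1:])) = {#a#} + mset xs"
      by (subst proots_mult) (auto simp: Cons.IH)
    thus ?case by (simp del: mult_pCons_left)
  qed simp
  thus ?thesis
    unfolding char_poly_upper_triangular[OF diagonal_of_carrier ut] diag .
qed

text \<open>The right half of the decomposition: a unitary \<open>P\<close> diagonalising
  \<open>mat_adjoint X * X\<close> makes the columns of \<open>X * P\<close> orthogonal. Similarity
  preserves the characteristic polynomial, so the lengths of these columns are the singular values
  with multiplicity.\<close>

lemma singular_value_decomposition:
  assumes X: "X \<in> carrier_mat n n"
  obtains P \<sigma> where "unitary_mat n P" "\<And>i. 0 \<le> \<sigma> i" "singular_values X = mset (map \<sigma> [0..<n])"
    "mat_adjoint (X * P) * (X * P) = diagonal_of n (\<lambda>i. of_real ((\<sigma> i)\<^sup>2))"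
proof -
  note X' = mat_adjoint_carrier[OF X]
  let ?H = "mat_adjoint X * X"
  have H: "?H \<in> carrier_mat n n" using X X' by auto
  have "mat_adjoint ?H = ?H" unfolding mat_adjoint_mult[OF X' X] by simp
  then obtain P g where uP: "unitary_mat n P" and Pg: "mat_adjoint P * ?H * P = diagonal_of n g"
    using hermitian_unitary_diagonalisation[OF H] by blast
  note P = unitary_matD(1)[OF uP]
  note P' = mat_adjoint_carrier[OF P]
  have XP: "X * P \<in> carrier_mat n n" using X P by auto
  have gram: "mat_adjoint (X * P) * (X * P) = diagonal_of n g"
  proof -
    have "mat_adjoint (X * P) * (X * P) = mat_adjoint P * (mat_adjoint X * (X * P))"
      unfolding mat_adjoint_mult[OF X P] by (rule assoc_mult_mat[OF P' X' XP])
    also have "mat_adjoint X * (X * P) = ?H * P" using assoc_mult_mat[OF X' X P] by simp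
    finally show ?thesis using Pg assoc_mult_mat[OF P' H P] by simp
  qed
  \<comment> \<open>With \<open>\<sigma> i\<close> taken as a column length, the eigenvalue
    \<open>g i\<close> equals its square and is thereby seen to be real and nonnegative.\<close>
  define \<sigma> where "\<sigma> i = vec_norm2 (col (X * P) i)" for i
  have g: "g i = of_real ((\<sigma> i)\<^sup>2)" if "i < n" for i
    using mat_adjoint_mult_index[OF XP XP that that] that
    unfolding gram \<sigma>_def cinner_self by (simp add: diagonal_of_def)
  have "similar_mat (diagonal_of n g) ?H"
    unfolding similar_mat_def
    using similar_mat_witI[OF unitary_matD(2,3)[OF uP] Pg[symmetric] diagonal_of_carrier H P' P] by blast
  hence "char_poly ?H = char_poly (diagonal_of n g)"
    by (simp add: char_poly_similar)
  hence "singular_values X = mset (map (\<lambda>i. sqrt (Re (g i))) [0..<n])"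
    unfolding singular_values_def by (simp add: proots_char_poly_diagonal_of multiset.map_comp o_def)
  also have "\<dots> = mset (map \<sigma> [0..<n])"
    by (rule arg_cong[where f = mset]) (auto simp: g \<sigma>_def simp del: of_real_power)
  finally have "singular_values X = mset (map \<sigma> [0..<n])" .
  moreover have "diagonal_of n g = diagonal_of n (\<lambda>i. of_real ((\<sigma> i)\<^sup>2))"
    by (rule eq_matI) (auto simp: diagonal_of_def g)
  ultimately show ?thesis using that[OF uP, of \<sigma>] gram by (simp add: \<sigma>_def)
qed

text \<open>Pythagoras: the columns of \<open>Y\<close> are orthogonal with squared lengths
  \<open>h i\<close>.\<close>

lemma vec_norm2_mult_diagonal_gram:
  assumes Y: "Y \<in> carrier_mat m n" and z: "z \<in> carrier_vec n"
    and gram: "mat_adjoint Y * Y = diagonal_of n (\<lambda>i. of_real (h i))"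
  shows "(vec_norm2 (Y *\<^sub>v z))\<^sup>2 = (\<Sum>i<n. h i * (cmod (z $ i))\<^sup>2)"
proof -
  have "(diagonal_of n (\<lambda>i. of_real (h i)) *\<^sub>v z) $ i = of_real (h i) * z $ i" if "i < n" for i
  proof -
    have "(diagonal_of n (\<lambda>i. of_real (h i)) *\<^sub>v z) $ i =
        (\<Sum>k<n. if i = k then of_real (h i) * z $ k else 0)"
      unfolding mult_mat_vec_index[OF diagonal_of_carrier z that] using that
      by (intro sum.cong) (auto simp: diagonal_of_def)
    thus ?thesis using that by (simp add: sum.delta)
  qed
  hence "cinner z (diagonal_of n (\<lambda>i. of_real (h i)) *\<^sub>v z) =
      (\<Sum>i<n. cnj (z $ i) * (of_real (h i) * z $ i))"
    unfolding cinner_def by (intro sum.cong) (auto simp: diagonal_of_def)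
  also have "\<dots> = (\<Sum>i<n. of_real (h i * (cmod (z $ i))\<^sup>2))"
    by (intro sum.cong refl) (simp add: complex_norm_square mult_ac del: of_real_power)
  finally have "complex_of_real ((vec_norm2 (Y *\<^sub>v z))\<^sup>2) = of_real (\<Sum>i<n. h i * (cmod (z $ i))\<^sup>2)"
    unfolding mult_mat_vec_norm2[OF Y z] gram by simp
  thus ?thesis by (simp only: of_real_eq_iff)
qed

section \<open>Operator bounds and trace duality\<close>

text \<open>An upper bound on the operator norm as a statement about vectors, so that sums, products
  and adjoints can be estimated without computing singular values.\<close>

definition op_bound :: "real \<Rightarrow> complex mat \<Rightarrow> bool" where
  "op_bound c A \<longleftrightarrow> (\<forall>v\<in>carrier_vec (dim_col A). vec_norm2 (A *\<^sub>v v) \<le> c * vec_norm2 v)"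

lemma op_boundI:
  assumes "A \<in> carrier_mat n m"
    and "\<And>v. v \<in> carrier_vec m \<Longrightarrow> vec_norm2 (A *\<^sub>v v) \<le> c * vec_norm2 v"
  shows "op_bound c A"
  using assms by (auto simp: op_bound_def)

lemma op_boundD:
  assumes "op_bound c A" "A \<in> carrier_mat n m" "v \<in> carrier_vec m"
  shows "vec_norm2 (A *\<^sub>v v) \<le> c * vec_norm2 v"
  using assms by (auto simp: op_bound_def)

lemma op_bound_mono: "op_bound c A \<Longrightarrow> c \<le> d \<Longrightarrow> op_bound d A"
  unfolding op_bound_def by (meson mult_right_mono order_trans vec_norm2_nonneg)

lemma op_bound_unitary: "unitary_mat n U \<Longrightarrow> op_bound 1 U"
  by (rule op_boundI[OF unitary_matD(1)]) (auto simp: unitary_mat_vec_norm2)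

lemma op_bound_mult:
  assumes "A \<in> carrier_mat n m" "B \<in> carrier_mat m p" "op_bound a A" "op_bound b B" "0 \<le> a"
  shows "op_bound (a * b) (A * B)"
proof (rule op_boundI)
  fix v :: "complex vec" assume v: "v \<in> carrier_vec p"
  have "vec_norm2 ((A * B) *\<^sub>v v) \<le> a * vec_norm2 (B *\<^sub>v v)"
    unfolding assoc_mult_mat_vec[OF assms(1,2) v]
    using assms v by (intro op_boundD[OF assms(3,1)]) auto
  also have "\<dots> \<le> a * (b * vec_norm2 v)"
    using op_boundD[OF assms(4,2) v] assms(5) by (rule mult_left_mono)
  finally show "vec_norm2 ((A * B) *\<^sub>v v) \<le> a * b * vec_norm2 v" by (simp add: mult_ac)
qed (use assms in auto)

lemma op_bound_add:
  assumes "A \<in> carrier_mat n m" "B \<in> carrier_mat n m" "op_bound a A" "op_bound b B"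
  shows "op_bound (a + b) (A + B)"
proof (rule op_boundI)
  fix v :: "complex vec" assume v: "v \<in> carrier_vec m"
  have "vec_norm2 ((A + B) *\<^sub>v v) \<le> vec_norm2 (A *\<^sub>v v) + vec_norm2 (B *\<^sub>v v)"
    unfolding add_mult_distrib_mat_vec[OF assms(1,2) v]
    using assms v by (intro vec_norm2_triangle[of _ n]) auto
  also have "\<dots> \<le> a * vec_norm2 v + b * vec_norm2 v"
    using op_boundD[OF assms(3,1) v] op_boundD[OF assms(4,2) v] by simp
  finally show "vec_norm2 ((A + B) *\<^sub>v v) \<le> (a + b) * vec_norm2 v" by (simp add: algebra_simps)
qed (use assms in auto)

lemma op_bound_smult:
  assumes A: "A \<in> carrier_mat n m" and b: "op_bound a A"
  shows "op_bound (cmod c * a) (c \<cdot>\<^sub>m A)"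
proof (rule op_boundI)
  fix v :: "complex vec" assume v: "v \<in> carrier_vec m"
  have "(c \<cdot>\<^sub>m A) *\<^sub>v v = c \<cdot>\<^sub>v (A *\<^sub>v v)" using A v by (intro eq_vecI) auto
  thus "vec_norm2 ((c \<cdot>\<^sub>m A) *\<^sub>v v) \<le> cmod c * a * vec_norm2 v"
    using mult_left_mono[OF op_boundD[OF b A v], of "cmod c"] by (simp add: vec_norm2_smult mult_ac)
qed (use A in auto)

lemma op_bound_minus_commute:
  assumes A: "A \<in> carrier_mat n m" and B: "B \<in> carrier_mat n m" and b: "op_bound a (A - B)"
  shows "op_bound a (B - A)"
proof -
  have "B - A = (-1) \<cdot>\<^sub>m (A - B)" using A B by (intro eq_matI) auto
  thus ?thesis using op_bound_smult[OF minus_carrier_mat[OF B] b, of "-1"] by simp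
qed

text \<open>With \<open>w\<close> the image of \<open>v\<close> under the adjoint, the square of the
  length of \<open>w\<close> is the inner product of \<open>v\<close> with
  \<open>A *\<^sub>v w\<close>. Cauchy-Schwarz and the bound on \<open>A\<close> leave one factor
  \<open>vec_norm2 w\<close> to cancel.\<close>

lemma op_bound_adjoint:
  assumes A: "A \<in> carrier_mat n m" and b: "op_bound c A" and c: "0 \<le> c"
  shows "op_bound c (mat_adjoint A)"
proof (rule op_boundI[OF mat_adjoint_carrier[OF A]])
  fix v :: "complex vec" assume v: "v \<in> carrier_vec n"
  note A' = mat_adjoint_carrier[OF A]
  let ?w = "mat_adjoint A *\<^sub>v v"
  have w: "?w \<in> carrier_vec m" using A' v by auto
  have "(vec_norm2 ?w)\<^sup>2 = cmod (cinner v (A *\<^sub>v ?w))"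
    unfolding cinner_adjoint[OF A v w] cinner_self norm_of_real by simp
  also have "\<dots> \<le> vec_norm2 v * vec_norm2 (A *\<^sub>v ?w)"
    using A v w by (intro cinner_le) auto
  also have "\<dots> \<le> vec_norm2 v * (c * vec_norm2 ?w)"
    by (intro mult_left_mono op_boundD[OF b A w]) auto
  finally have "vec_norm2 ?w * vec_norm2 ?w \<le> c * vec_norm2 v * vec_norm2 ?w"
    by (simp add: power2_eq_square mult_ac)
  thus "vec_norm2 ?w \<le> c * vec_norm2 v"
    using c by (cases "vec_norm2 ?w = 0") (auto simp: less_le)
qed

text \<open>Links the spectral definition to \<open>op_bound\<close>: in the orthonormal basis given
  by \<open>P\<close>, the squared length of the image weights the squared coordinates by
  \<open>(\<sigma> i)\<^sup>2\<close>, each at most the square of the largest singular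
  value.\<close>

lemma op_bound_op_norm:
  assumes X: "X \<in> carrier_mat n n"
  shows "op_bound (op_norm X) X"
proof (rule op_boundI[OF X])
  fix v :: "complex vec" assume v: "v \<in> carrier_vec n"
  obtain P \<sigma> where uP: "unitary_mat n P" and \<sigma>: "\<And>i. 0 \<le> \<sigma> i"
    and sv: "singular_values X = mset (map \<sigma> [0..<n])"
    and gram: "mat_adjoint (X * P) * (X * P) = diagonal_of n (\<lambda>i. of_real ((\<sigma> i)\<^sup>2))"
    using singular_value_decomposition[OF X] by blast
  note P = unitary_matD(1)[OF uP]
  note P' = mat_adjoint_carrier[OF P]
  define z where "z = mat_adjoint P *\<^sub>v v"
  have z: "z \<in> carrier_vec n" unfolding z_def using P' v by auto
  have nz: "vec_norm2 z = vec_norm2 v"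
    unfolding z_def by (rule unitary_mat_vec_norm2[OF unitary_mat_adjoint[OF uP] v])
  have Pz: "P *\<^sub>v z = v"
    unfolding z_def assoc_mult_mat_vec[OF P P' v, symmetric] unitary_matD(3)[OF uP] using v by simp
  have le: "\<sigma> i \<le> op_norm X" if "i < n" for i
    unfolding op_norm_def sv using that by (intro Max_ge) auto
  have "(vec_norm2 (X *\<^sub>v v))\<^sup>2 = (\<Sum>i<n. (\<sigma> i)\<^sup>2 * (cmod (z $ i))\<^sup>2)"
    using vec_norm2_mult_diagonal_gram[OF mult_carrier_mat[OF X P] z gram]
    unfolding assoc_mult_mat_vec[OF X P z] Pz .
  also have "\<dots> \<le> (\<Sum>i<n. (op_norm X)\<^sup>2 * (cmod (z $ i))\<^sup>2)"
    by (intro sum_mono mult_right_mono power_mono) (auto simp: le \<sigma>)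
  also have "\<dots> = (op_norm X * vec_norm2 v)\<^sup>2"
    unfolding nz[symmetric] power_mult_distrib vec_norm2_sq[OF z] sum_distrib_left ..
  finally have *: "(vec_norm2 (X *\<^sub>v v))\<^sup>2 \<le> (op_norm X * vec_norm2 v)\<^sup>2" .
  show "vec_norm2 (X *\<^sub>v v) \<le> op_norm X * vec_norm2 v"
  \<comment> \<open>For \<open>n = 0\<close> the maximum in \<open>op_norm\<close> is over the empty
    set and its sign is unknown; all vectors then have length 0.\<close>
  proof (cases "n = 0")
    case True
    thus ?thesis using X v by (simp add: vec_norm2_def)
  next
    case False
    hence "0 \<le> op_norm X" using le[of 0] \<sigma>[of 0] by auto
    thus ?thesis using * by (intro power2_le_imp_le[OF *]) auto
  qed
qed

section \<open>Trace and the duality between trace norm and operator norm\<close>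

definition mat_trace :: "complex mat \<Rightarrow> complex" where
  "mat_trace A = (\<Sum>i<dim_row A. A $$ (i, i))"

lemma mat_trace_mult:
  assumes "A \<in> carrier_mat n m" "B \<in> carrier_mat m n"
  shows "mat_trace (A * B) = (\<Sum>i<n. \<Sum>j<m. A $$ (i, j) * B $$ (j, i))"
  using assms unfolding mat_trace_def
  by (auto simp: mult_mat_index[OF assms] simp del: index_mult_mat(1) intro!: sum.cong)

lemma mat_trace_mult_commute:
  assumes "A \<in> carrier_mat n m" "B \<in> carrier_mat m n"
  shows "mat_trace (A * B) = mat_trace (B * A)"
  unfolding mat_trace_mult[OF assms] mat_trace_mult[OF assms(2,1)]
  by (subst sum.swap) (simp add: mult.commute)

text \<open>Hoelder's inequality. Conjugating by \<open>P\<close> turns the trace into that of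
  \<open>(mat_adjoint P * W) * (X * P)\<close>, whose diagonal entry \<open>i\<close> is at most
  \<open>c\<close> times the length \<open>\<sigma> i\<close> of column \<open>i\<close> of
  \<open>X * P\<close>.\<close>

lemma norm_trace_mult_le:
  assumes W: "W \<in> carrier_mat n n" and X: "X \<in> carrier_mat n n"
    and b: "op_bound c W" and c: "0 \<le> c"
  shows "cmod (mat_trace (W * X)) \<le> c * trace_norm X"
proof -
  obtain P \<sigma> where uP: "unitary_mat n P" and \<sigma>: "\<And>i. 0 \<le> \<sigma> i"
    and sv: "singular_values X = mset (map \<sigma> [0..<n])"
    and gram: "mat_adjoint (X * P) * (X * P) = diagonal_of n (\<lambda>i. of_real ((\<sigma> i)\<^sup>2))"
    using singular_value_decomposition[OF X] by blast
  note P = unitary_matD(1)[OF uP]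
  note P' = mat_adjoint_carrier[OF P]
  have XP: "X * P \<in> carrier_mat n n" using X P by auto
  define Z where "Z = mat_adjoint P * W"
  have Z: "Z \<in> carrier_mat n n" unfolding Z_def using P' W by auto
  have bZ: "op_bound c Z"
    using op_bound_mult[OF P' W op_bound_unitary[OF unitary_mat_adjoint[OF uP]] b]
    by (simp add: Z_def)
  have ZXP: "Z * (X * P) \<in> carrier_mat n n" using Z XP by auto
  have colY: "vec_norm2 (col (X * P) i) = \<sigma> i" if i: "i < n" for i
  proof -
    have "complex_of_real ((vec_norm2 (col (X * P) i))\<^sup>2) = of_real ((\<sigma> i)\<^sup>2)"
      using mat_adjoint_mult_index[OF XP XP i i] i unfolding gram
      by (simp add: diagonal_of_def cinner_self)
    hence "(vec_norm2 (col (X * P) i))\<^sup>2 = (\<sigma> i)\<^sup>2" by (simp only: of_real_eq_iff)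
    thus ?thesis using \<sigma> by (simp add: power2_eq_iff_nonneg)
  qed
  have "mat_trace (W * X) = mat_trace (Z * (X * P))"
  proof -
    have "Z * (X * P) = mat_adjoint P * (W * (X * P))"
      unfolding Z_def by (rule assoc_mult_mat[OF P' W XP])
    hence "mat_trace (Z * (X * P)) = mat_trace (W * (X * P) * mat_adjoint P)"
      using mat_trace_mult_commute[OF P', of "W * (X * P)"] W XP by simp
    also have "W * (X * P) * mat_adjoint P = W * (X * P * mat_adjoint P)"
      by (rule assoc_mult_mat[OF W XP P'])
    also have "X * P * mat_adjoint P = X"
      unfolding assoc_mult_mat[OF X P P'] unitary_matD(3)[OF uP] using X by simp
    finally show ?thesis ..
  qed
  also have "cmod \<dots> \<le> (\<Sum>i<n. cmod ((Z * (X * P)) $$ (i, i)))"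
    unfolding mat_trace_def using Z by (simp add: norm_sum del: index_mult_mat(1))
  also have "\<dots> \<le> (\<Sum>i<n. c * \<sigma> i)"
  proof (rule sum_mono)
    fix i assume "i \<in> {..<n}"
    hence i: "i < n" by simp
    have "cmod ((Z * (X * P)) $$ (i, i)) = cmod (col (Z * (X * P)) i $ i)"
      using ZXP i by (subst index_col) auto
    also have "\<dots> \<le> vec_norm2 (col (Z * (X * P)) i)"
      using Z i by (intro norm_index_le_vec_norm2) auto
    also have "col (Z * (X * P)) i = Z *\<^sub>v col (X * P) i" using Z XP i by auto
    also have "vec_norm2 \<dots> \<le> c * vec_norm2 (col (X * P) i)"
      using XP i by (intro op_boundD[OF bZ Z]) auto
    finally show "cmod ((Z * (X * P)) $$ (i, i)) \<le> c * \<sigma> i" using colY[OF i] by simp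
  qed
  also have "\<dots> = c * trace_norm X"
    unfolding trace_norm_def sv
    by (simp add: sum_distrib_left[symmetric] sum_mset_sum_list interv_sum_list_conv_sum_set_nat atLeast0LessThan del: mset_map)
  finally show ?thesis .
qed

text \<open>Equality in the duality: \<open>W\<close> is the adjoint of the partial isometry in the
  polar decomposition of \<open>X\<close>. It turns a trace norm into a single trace, which can be
  expanded linearly.\<close>

lemma trace_norm_attained:
  assumes X: "X \<in> carrier_mat n n"
  obtains W where "W \<in> carrier_mat n n" "op_bound 1 W" "mat_trace (W * X) = of_real (trace_norm X)"
proof -
  obtain P \<sigma> where uP: "unitary_mat n P" and \<sigma>: "\<And>i. 0 \<le> \<sigma> i"
    and sv: "singular_values X = mset (map \<sigma> [0..<n])"
    and gram: "mat_adjoint (X * P) * (X * P) = diagonal_of n (\<lambda>i. of_real ((\<sigma> i)\<^sup>2))"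
    using singular_value_decomposition[OF X] by blast
  note P = unitary_matD(1)[OF uP]
  note P' = mat_adjoint_carrier[OF P]
  have XP: "X * P \<in> carrier_mat n n" using X P by auto
  note XP' = mat_adjoint_carrier[OF XP]
  \<comment> \<open>Since \<open>inverse 0 = 0\<close>, this is a pseudo-inverse: multiplying
    \<open>X * P\<close> by \<open>D\<close> normalises the nonzero columns and leaves the zero ones
    zero.\<close>
  define D where "D = diagonal_of n (\<lambda>i. of_real (inverse (\<sigma> i)))"
  have D: "D \<in> carrier_mat n n" by (simp add: D_def)
  have D_mult: "(diagonal_of n g * diagonal_of n h) = diagonal_of n (\<lambda>i. g i * h i)" for g h
  proof (rule eq_matI)
    fix i j assume "i < dim_row (diagonal_of n (\<lambda>i. g i * h i))"
      "j < dim_col (diagonal_of n (\<lambda>i. g i * h i))"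
    hence ij: "i < n" "j < n" by (auto simp: diagonal_of_def)
    have "(diagonal_of n g * diagonal_of n h) $$ (i, j) =
        (\<Sum>k<n. if i = k then (if k = j then g i * h j else 0) else 0)"
      unfolding mult_mat_index[OF diagonal_of_carrier diagonal_of_carrier ij]
      using ij by (intro sum.cong) (auto simp: diagonal_of_def)
    thus "(diagonal_of n g * diagonal_of n h) $$ (i, j) = diagonal_of n (\<lambda>i. g i * h i) $$ (i, j)"
      using ij by (auto simp: diagonal_of_def)
  qed (auto simp: diagonal_of_def)
  have D': "mat_adjoint D = D"
  proof (rule eq_matI)
    fix i j assume "i < dim_row D" "j < dim_col D"
    hence ij: "i < n" "j < n" using D by auto
    show "mat_adjoint D $$ (i, j) = D $$ (i, j)"
      using ij unfolding mat_adjoint_index[OF D ij] by (auto simp: D_def diagonal_of_def)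
  qed (use D in auto)
  have YD: "X * P * D \<in> carrier_mat n n" using XP D by auto
  have gramD: "mat_adjoint (X * P * D) * (X * P * D) =
      diagonal_of n (\<lambda>i. of_real (inverse (\<sigma> i) * ((\<sigma> i)\<^sup>2 * inverse (\<sigma> i))))"
  proof -
    have "mat_adjoint (X * P * D) * (X * P * D) = D * (mat_adjoint (X * P) * (X * P * D))"
      unfolding mat_adjoint_mult[OF XP D] D' by (rule assoc_mult_mat[OF D XP' YD])
    also have "mat_adjoint (X * P) * (X * P * D) = mat_adjoint (X * P) * (X * P) * D"
      using assoc_mult_mat[OF XP' XP D] by simp
    finally show ?thesis unfolding gram unfolding D_def D_mult by simp
  qed
  \<comment> \<open>The diagonal Gram entries are 1 where \<open>\<sigma> i\<close> is nonzero and 0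
    elsewhere, hence a contraction.\<close>
  have "op_bound 1 (X * P * D)"
  proof (rule op_boundI[OF YD])
    fix z :: "complex vec" assume z: "z \<in> carrier_vec n"
    have "(vec_norm2 ((X * P * D) *\<^sub>v z))\<^sup>2 \<le> (\<Sum>i<n. (cmod (z $ i))\<^sup>2)"
      unfolding vec_norm2_mult_diagonal_gram[OF YD z gramD]
    proof (rule sum_mono)
      fix i
      have "inverse (\<sigma> i) * ((\<sigma> i)\<^sup>2 * inverse (\<sigma> i)) \<le> 1"
        by (cases "\<sigma> i = 0") (auto simp: power2_eq_square field_simps)
      from mult_right_mono[OF this, of "(cmod (z $ i))\<^sup>2"]
      show "inverse (\<sigma> i) * ((\<sigma> i)\<^sup>2 * inverse (\<sigma> i)) * (cmod (z $ i))\<^sup>2 \<le> (cmod (z $ i))\<^sup>2" by simp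
    qed
    hence "vec_norm2 ((X * P * D) *\<^sub>v z) \<le> vec_norm2 z"
      unfolding vec_norm2_sq[OF z, symmetric] by (rule power2_le_imp_le) simp
    thus "vec_norm2 ((X * P * D) *\<^sub>v z) \<le> 1 * vec_norm2 z" by simp
  qed
  hence bYD: "op_bound 1 (mat_adjoint (X * P * D))" by (rule op_bound_adjoint[OF YD]) simp
  note YD' = mat_adjoint_carrier[OF YD]
  define W where "W = P * mat_adjoint (X * P * D)"
  have W: "W \<in> carrier_mat n n" unfolding W_def using P YD' by auto
  have bW: "op_bound 1 W"
    unfolding W_def using op_bound_mult[OF P YD' op_bound_unitary[OF uP] bYD] by simp
  have "W * X = P * (mat_adjoint (X * P * D) * X)"
    unfolding W_def by (rule assoc_mult_mat[OF P YD' X])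
  hence "mat_trace (W * X) = mat_trace (mat_adjoint (X * P * D) * X * P)"
    using mat_trace_mult_commute[OF P, of "mat_adjoint (X * P * D) * X"] YD' X by simp
  also have "mat_adjoint (X * P * D) * X * P = D * (mat_adjoint (X * P) * (X * P))"
    using assoc_mult_mat[OF YD' X P] assoc_mult_mat[OF D XP' XP]
    by (simp add: mat_adjoint_mult[OF XP D] D')
  also have "mat_trace \<dots> = (\<Sum>i<n. of_real (inverse (\<sigma> i) * (\<sigma> i)\<^sup>2))"
    unfolding gram unfolding D_def D_mult mat_trace_def by (simp add: diagonal_of_def)
  also have "\<dots> = (\<Sum>i<n. of_real (\<sigma> i))"
    by (intro sum.cong refl arg_cong[where f = of_real]) (simp add: power2_eq_square field_simps)
  also have "\<dots> = of_real (trace_norm X)"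
    unfolding trace_norm_def sv
    by (simp add: sum_mset_sum_list interv_sum_list_conv_sum_set_nat atLeast0LessThan del: mset_map)
  finally show ?thesis using that[OF W bW] by simp
qed

section \<open>Ampliations and the diamond distance\<close>

lemma sum_lessThan_mult:
  fixes f :: "nat \<Rightarrow> 'a :: comm_monoid_add"
  shows "(\<Sum>t<D * k. f t) = (\<Sum>i<D. \<Sum>a<k. f (i * k + a))"
  by (simp add: sum.nat_group[symmetric] sum.atLeastLessThan_shift_0 atLeast0LessThan add.commute)

lemma kron_carrier: "A \<in> carrier_mat D D \<Longrightarrow> kron A (1\<^sub>m k) \<in> carrier_mat (D * k) (D * k)"
  by (auto simp: kron_def)

lemma kron_one_index:
  assumes A: "A \<in> carrier_mat D D" and "r < D * k" "t < D * k"
  shows "kron A (1\<^sub>m k) $$ (r, t) = A $$ (r div k, t div k) * (if r mod k = t mod k then 1 else 0)"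
proof -
  have "k > 0" using assms by (cases k) auto
  thus ?thesis using assms by (auto simp: kron_def)
qed

lemma mult_add_less_mult:
  fixes i a k D :: nat
  assumes "i < D" "a < k"
  shows "i * k + a < D * k"
proof -
  have "i * k + a < Suc i * k" using assms by simp
  also have "\<dots> \<le> D * k" using assms by (intro mult_le_mono1) simp
  finally show ?thesis .
qed

text \<open>Row \<open>r\<close> is supported on the columns with auxiliary index
  \<open>r mod k\<close>, so the sum over pairs collapses to one over the first factor.\<close>

lemma sum_kron_one:
  assumes A: "A \<in> carrier_mat D D" and r: "r < D * k"
  shows "(\<Sum>t<D * k. kron A (1\<^sub>m k) $$ (r, t) * g t) = (\<Sum>i<D. A $$ (r div k, i) * g (i * k + r mod k))"
proof -
  have k: "k > 0" using r by (cases k) auto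
  have "(\<Sum>a<k. kron A (1\<^sub>m k) $$ (r, i * k + a) * g (i * k + a)) = A $$ (r div k, i) * g (i * k + r mod k)"
    if i: "i < D" for i
  proof -
    have "(\<Sum>a<k. kron A (1\<^sub>m k) $$ (r, i * k + a) * g (i * k + a)) =
        (\<Sum>a<k. if r mod k = a then A $$ (r div k, i) * g (i * k + a) else 0)"
      using kron_one_index[OF A r mult_add_less_mult[OF i]] by (intro sum.cong) auto
    thus ?thesis using k by simp
  qed
  thus ?thesis by (simp add: sum_lessThan_mult)
qed

text \<open>Cut \<open>v\<close> into one slice \<open>w a\<close> per auxiliary index:
  \<open>A\<close> acts on each slice separately and squared lengths add up. The bound does not grow
  with \<open>k\<close>, which makes the diamond estimate uniform in the auxiliary
  dimension.\<close>

lemma op_bound_kron: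
  assumes A: "A \<in> carrier_mat D D" and b: "op_bound c A" and c: "0 \<le> c"
  shows "op_bound c (kron A (1\<^sub>m k))"
proof (rule op_boundI[OF kron_carrier[OF A]])
  fix v :: "complex vec" assume v: "v \<in> carrier_vec (D * k)"
  let ?K = "kron A (1\<^sub>m k)"
  have K: "?K \<in> carrier_mat (D * k) (D * k)" by (rule kron_carrier[OF A])
  define w where "w a = vec D (\<lambda>i. v $ (i * k + a))" for a
  have w: "w a \<in> carrier_vec D" for a by (simp add: w_def)
  have Kv: "(?K *\<^sub>v v) $ (i * k + a) = (A *\<^sub>v w a) $ i" if "i < D" "a < k" for i a
    unfolding mult_mat_vec_index[OF K v mult_add_less_mult[OF that]] sum_kron_one[OF A mult_add_less_mult[OF that]]
      mult_mat_vec_index[OF A w that(1)] using that by (simp add: w_def)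
  have "(vec_norm2 (?K *\<^sub>v v))\<^sup>2 = (\<Sum>i<D. \<Sum>a<k. (cmod ((?K *\<^sub>v v) $ (i * k + a)))\<^sup>2)"
    using vec_norm2_sq[OF mult_mat_vec_carrier[OF K v]] by (simp add: sum_lessThan_mult)
  also have "\<dots> = (\<Sum>i<D. \<Sum>a<k. (cmod ((A *\<^sub>v w a) $ i))\<^sup>2)"
    by (intro sum.cong refl) (simp only: lessThan_iff Kv)
  also have "\<dots> = (\<Sum>a<k. \<Sum>i<D. (cmod ((A *\<^sub>v w a) $ i))\<^sup>2)"
    by (rule sum.swap)
  also have "\<dots> = (\<Sum>a<k. (vec_norm2 (A *\<^sub>v w a))\<^sup>2)"
    using vec_norm2_sq[OF mult_mat_vec_carrier[OF A w]] by simp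
  also have "\<dots> \<le> (\<Sum>a<k. (c * vec_norm2 (w a))\<^sup>2)"
    by (intro sum_mono power_mono op_boundD[OF b A w]) simp
  also have "\<dots> = c\<^sup>2 * (\<Sum>a<k. \<Sum>i<D. (cmod (v $ (i * k + a)))\<^sup>2)"
    by (simp add: power_mult_distrib sum_distrib_left vec_norm2_sq[OF w]) (simp add: w_def)
  also have "(\<Sum>a<k. \<Sum>i<D. (cmod (v $ (i * k + a)))\<^sup>2) = (\<Sum>i<D. \<Sum>a<k. (cmod (v $ (i * k + a)))\<^sup>2)"
    by (rule sum.swap)
  also have "c\<^sup>2 * \<dots> = (c * vec_norm2 v)\<^sup>2"
    by (simp add: vec_norm2_sq[OF v] sum_lessThan_mult power_mult_distrib)
  finally show "vec_norm2 (?K *\<^sub>v v) \<le> c * vec_norm2 v"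
    by (rule power2_le_imp_le) (use c in simp)
qed

text \<open>Conjugation by \<open>A\<close> on the first factor only is conjugation by
  \<open>kron A (1\<^sub>m k)\<close>; the right side is the entry that \<open>tensor_id\<close>
  prescribes.\<close>

lemma kron_conjugation_index:
  assumes A: "A \<in> carrier_mat D D" and X: "X \<in> carrier_mat (D * k) (D * k)"
    and rs: "r < D * k" "s < D * k"
  shows "(kron A (1\<^sub>m k) * X * mat_adjoint (kron A (1\<^sub>m k))) $$ (r, s) =
    unitary_channel A (aux_block D k X (r mod k) (s mod k)) $$ (r div k, s div k)"
proof -
  let ?K = "kron A (1\<^sub>m k)"
  let ?B = "aux_block D k X (r mod k) (s mod k)"
  have K: "?K \<in> carrier_mat (D * k) (D * k)" by (rule kron_carrier[OF A])
  have B: "?B \<in> carrier_mat D D" by (simp add: aux_block_def)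
  note A' = mat_adjoint_carrier[OF A] and K' = mat_adjoint_carrier[OF K]
  have k: "k > 0" using rs by (cases k) auto
  have div: "r div k < D" "s div k < D" using rs by (simp_all add: less_mult_imp_div_less)
  have lt: "j * k + s mod k < D * k" if "j < D" for j
    using k that by (intro mult_add_less_mult) auto
  have KX: "?K * X \<in> carrier_mat (D * k) (D * k)" using K X by auto
  have AB: "A * ?B \<in> carrier_mat D D" using A B by auto
  have AB_index: "(A * ?B) $$ (r div k, j) = (?K * X) $$ (r, j * k + s mod k)" if j: "j < D" for j
    unfolding mult_mat_index[OF A B div(1) j] mult_mat_index[OF K X rs(1) lt[OF j]]
      sum_kron_one[OF A rs(1)]
    using j by (intro sum.cong) (auto simp: aux_block_def)
  \<comment> \<open>Conjugating the whole sum brings row \<open>s\<close> of \<open>?K\<close> to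
    the front, so that \<open>sum_kron_one\<close> applies a second time.\<close>
  have "(?K * X * mat_adjoint ?K) $$ (r, s) = cnj (\<Sum>t<D * k. ?K $$ (s, t) * cnj ((?K * X) $$ (r, t)))"
    unfolding mult_mat_index[OF KX K' rs] cnj_sum
    using rs by (intro sum.cong) (auto simp: mat_adjoint_index[OF K])
  also have "\<dots> = (\<Sum>j<D. (A * ?B) $$ (r div k, j) * mat_adjoint A $$ (j, s div k))"
    unfolding sum_kron_one[OF A rs(2)] cnj_sum
    using div(2) by (intro sum.cong) (auto simp: AB_index mat_adjoint_index[OF A])
  also have "\<dots> = unitary_channel A ?B $$ (r div k, s div k)"
    unfolding unitary_channel_def mult_mat_index[OF AB A' div] ..
  finally show ?thesis .
qed

section \<open>Weighted averages of matrices\<close>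

definition mean_mat :: "nat \<Rightarrow> nat \<Rightarrow> (nat \<Rightarrow> real) \<Rightarrow> (nat \<Rightarrow> complex mat) \<Rightarrow> complex mat" where
  "mean_mat D n p U = mat D D (\<lambda>(i, j). \<Sum>l<n. complex_of_real (p l) * U l $$ (i, j))"

lemma mean_mat_carrier [simp]: "mean_mat D n p U \<in> carrier_mat D D"
  by (simp add: mean_mat_def)

text \<open>Triangle inequality by induction on \<open>n\<close>. The total weight stays in the
  bound because the induction passes through partial sums.\<close>

lemma op_bound_mean_mat:
  assumes "\<And>l. l < n \<Longrightarrow> U l \<in> carrier_mat D D" "\<And>l. l < n \<Longrightarrow> op_bound c (U l)"
    and "\<And>l. l < n \<Longrightarrow> 0 \<le> p l"
  shows "op_bound ((\<Sum>l<n. p l) * c) (mean_mat D n p U)"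
  using assms
proof (induction n)
  case 0
  have "mean_mat D 0 p U *\<^sub>v v = 0\<^sub>v D" if "v \<in> carrier_vec D" for v
    using that by (intro eq_vecI) (auto simp: mean_mat_def scalar_prod_def)
  thus ?case by (intro op_boundI[OF mean_mat_carrier]) (auto simp: vec_norm2_def L2_set_def)
next
  case (Suc n)
  have "mean_mat D (Suc n) p U = mean_mat D n p U + complex_of_real (p n) \<cdot>\<^sub>m U n"
    using Suc.prems(1)[of n] by (intro eq_matI) (auto simp: mean_mat_def)
  moreover have "op_bound ((\<Sum>l<n. p l) * c + cmod (complex_of_real (p n)) * c)
      (mean_mat D n p U + complex_of_real (p n) \<cdot>\<^sub>m U n)"
    using Suc.prems by (intro op_bound_add[of _ D D] op_bound_smult[of _ D D] Suc.IH) auto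
  ultimately show ?case using Suc.prems(3)[of n] by (simp add: algebra_simps)
qed

section \<open>A sesquilinear trace form for conjugation maps\<close>

lemma mat_trace_adjoint:
  assumes "A \<in> carrier_mat n n"
  shows "mat_trace (mat_adjoint A) = cnj (mat_trace A)"
  using assms by (auto simp: mat_trace_def mat_adjoint_index[OF assms])

lemma mat_trace_minus:
  "A \<in> carrier_mat n n \<Longrightarrow> B \<in> carrier_mat n n \<Longrightarrow> mat_trace (A - B) = mat_trace A - mat_trace B"
  by (auto simp: mat_trace_def sum_subtractf)

text \<open>Linear in \<open>A\<close> and conjugate-linear in \<open>B\<close>. Separating the two
  sides of the conjugation lets each be expanded around \<open>V\<close> on its own.\<close>

definition conj_trace ::
    "nat \<Rightarrow> complex mat \<Rightarrow> complex mat \<Rightarrow> complex mat \<Rightarrow> complex mat \<Rightarrow> complex" where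
  "conj_trace k W X A B = mat_trace (W * (kron A (1\<^sub>m k) * X * mat_adjoint (kron B (1\<^sub>m k))))"

text \<open>Cyclicity brings \<open>A\<close> to the front, where linearity in \<open>A\<close> can
  be read off.\<close>

lemma conj_trace_left:
  assumes W: "W \<in> carrier_mat (D * k) (D * k)" and X: "X \<in> carrier_mat (D * k) (D * k)"
    and A: "A \<in> carrier_mat D D" and B: "B \<in> carrier_mat D D"
  shows "conj_trace k W X A B =
    mat_trace (kron A (1\<^sub>m k) * (X * mat_adjoint (kron B (1\<^sub>m k)) * W))"
proof -
  note K = kron_carrier[OF A, of k]
  note L = mat_adjoint_carrier[OF kron_carrier[OF B, of k]]
  have XL: "X * mat_adjoint (kron B (1\<^sub>m k)) \<in> carrier_mat (D * k) (D * k)" using X L by auto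
  have "conj_trace k W X A B =
      mat_trace (W * (kron A (1\<^sub>m k) * (X * mat_adjoint (kron B (1\<^sub>m k)))))"
    unfolding conj_trace_def assoc_mult_mat[OF K X L] ..
  also have "\<dots> = mat_trace (kron A (1\<^sub>m k) * (X * mat_adjoint (kron B (1\<^sub>m k))) * W)"
    using W K XL by (intro mat_trace_mult_commute) auto
  also have "kron A (1\<^sub>m k) * (X * mat_adjoint (kron B (1\<^sub>m k))) * W =
      kron A (1\<^sub>m k) * (X * mat_adjoint (kron B (1\<^sub>m k)) * W)"
    by (rule assoc_mult_mat[OF K XL W])
  finally show ?thesis .
qed

text \<open>Passing to the adjoint brings \<open>B\<close> to the front at the price of a
  conjugation, which is harmless for differences and real weights.\<close>

lemma conj_trace_right:
  assumes W: "W \<in> carrier_mat (D * k) (D * k)" and X: "X \<in> carrier_mat (D * k) (D * k)"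
    and A: "A \<in> carrier_mat D D" and B: "B \<in> carrier_mat D D"
  shows "conj_trace k W X A B =
    cnj (mat_trace (kron B (1\<^sub>m k) * mat_adjoint (W * kron A (1\<^sub>m k) * X)))"
proof -
  note K = kron_carrier[OF A, of k]
  note KB = kron_carrier[OF B, of k]
  note L = mat_adjoint_carrier[OF KB]
  have KX: "kron A (1\<^sub>m k) * X \<in> carrier_mat (D * k) (D * k)" using X K by auto
  have WK: "W * kron A (1\<^sub>m k) * X \<in> carrier_mat (D * k) (D * k)" using X K W by auto
  have "W * (kron A (1\<^sub>m k) * X * mat_adjoint (kron B (1\<^sub>m k))) =
      W * kron A (1\<^sub>m k) * X * mat_adjoint (kron B (1\<^sub>m k))"
    using assoc_mult_mat[OF W KX L] assoc_mult_mat[OF W K X] by simp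
  also have "\<dots> = mat_adjoint (kron B (1\<^sub>m k) * mat_adjoint (W * kron A (1\<^sub>m k) * X))"
    unfolding mat_adjoint_mult[OF KB mat_adjoint_carrier[OF WK]] by simp
  finally show ?thesis
    unfolding conj_trace_def using KB WK mat_adjoint_carrier[OF WK]
    by (simp only:) (intro mat_trace_adjoint mult_carrier_mat)
qed

lemma mat_trace_kron_minus:
  assumes A: "A \<in> carrier_mat D D" and B: "B \<in> carrier_mat D D"
    and Y: "Y \<in> carrier_mat (D * k) (D * k)"
  shows "mat_trace (kron (A - B) (1\<^sub>m k) * Y) =
    mat_trace (kron A (1\<^sub>m k) * Y) - mat_trace (kron B (1\<^sub>m k) * Y)"
proof -
  note K = kron_carrier[OF A, of k] kron_carrier[OF B, of k]
  have "kron (A - B) (1\<^sub>m k) = kron A (1\<^sub>m k) - kron B (1\<^sub>m k)"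
  proof (rule eq_matI)
    fix i j assume "i < dim_row (kron A (1\<^sub>m k) - kron B (1\<^sub>m k))"
      "j < dim_col (kron A (1\<^sub>m k) - kron B (1\<^sub>m k))"
    hence ij: "i < D * k" "j < D * k" using K by auto
    have "i div k < D" "j div k < D" using ij by (simp_all add: less_mult_imp_div_less)
    thus "kron (A - B) (1\<^sub>m k) $$ (i, j) = (kron A (1\<^sub>m k) - kron B (1\<^sub>m k)) $$ (i, j)"
      using ij A B K
      by (simp add: kron_one_index[OF A ij] kron_one_index[OF B ij]
          kron_one_index[OF minus_carrier_mat[OF B] ij] algebra_simps)
  qed (use A B in \<open>auto simp: kron_def\<close>)
  thus ?thesis
    using minus_mult_distrib_mat[OF K Y] mat_trace_minus[OF mult_carrier_mat[OF K(1) Y] mult_carrier_mat[OF K(2) Y]]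
    by simp
qed

lemma mat_trace_kron_mean:
  assumes U: "\<And>l. l < n \<Longrightarrow> U l \<in> carrier_mat D D" and Y: "Y \<in> carrier_mat (D * k) (D * k)"
  shows "mat_trace (kron (mean_mat D n p U) (1\<^sub>m k) * Y) =
    (\<Sum>l<n. of_real (p l) * mat_trace (kron (U l) (1\<^sub>m k) * Y))"
proof -
  have entry: "kron (mean_mat D n p U) (1\<^sub>m k) $$ (r, t) =
      (\<Sum>l<n. of_real (p l) * kron (U l) (1\<^sub>m k) $$ (r, t))" if rt: "r < D * k" "t < D * k" for r t
  proof -
    have "r div k < D" "t div k < D" using rt by (simp_all add: less_mult_imp_div_less)
    thus ?thesis
      using U unfolding kron_one_index[OF mean_mat_carrier rt]
      by (auto simp: mean_mat_def kron_one_index[OF U rt] sum_distrib_right mult_ac intro!: sum.cong)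
  qed
  have "mat_trace (kron (mean_mat D n p U) (1\<^sub>m k) * Y) =
      (\<Sum>r<D * k. \<Sum>t<D * k. \<Sum>l<n. of_real (p l) * (kron (U l) (1\<^sub>m k) $$ (r, t) * Y $$ (t, r)))"
    unfolding mat_trace_mult[OF kron_carrier[OF mean_mat_carrier] Y]
    by (intro sum.cong refl) (auto simp: entry sum_distrib_left sum_distrib_right mult_ac intro!: sum.cong)
  also have "\<dots> = (\<Sum>r<D * k. \<Sum>l<n. \<Sum>t<D * k. of_real (p l) * (kron (U l) (1\<^sub>m k) $$ (r, t) * Y $$ (t, r)))"
    by (intro sum.cong refl sum.swap)
  also have "\<dots> = (\<Sum>l<n. \<Sum>r<D * k. \<Sum>t<D * k. of_real (p l) * (kron (U l) (1\<^sub>m k) $$ (r, t) * Y $$ (t, r)))"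
    by (rule sum.swap)
  also have "\<dots> = (\<Sum>l<n. of_real (p l) * mat_trace (kron (U l) (1\<^sub>m k) * Y))"
    by (intro sum.cong refl) (auto simp: mat_trace_mult[OF kron_carrier[OF U] Y] sum_distrib_left)
  finally show ?thesis .
qed

lemma conj_trace_minus_left:
  assumes W: "W \<in> carrier_mat (D * k) (D * k)" and X: "X \<in> carrier_mat (D * k) (D * k)"
    and AB: "A \<in> carrier_mat D D" "A' \<in> carrier_mat D D" "B \<in> carrier_mat D D"
  shows "conj_trace k W X (A - A') B = conj_trace k W X A B - conj_trace k W X A' B"
proof -
  have Y: "X * mat_adjoint (kron B (1\<^sub>m k)) * W \<in> carrier_mat (D * k) (D * k)"
    using X W kron_carrier[OF AB(3), of k] by auto
  show ?thesis
    using AB by (simp add: conj_trace_left[OF W X] minus_carrier_mat mat_trace_kron_minus[OF AB(1,2) Y])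
qed

lemma conj_trace_minus_right:
  assumes W: "W \<in> carrier_mat (D * k) (D * k)" and X: "X \<in> carrier_mat (D * k) (D * k)"
    and AB: "A \<in> carrier_mat D D" "B \<in> carrier_mat D D" "B' \<in> carrier_mat D D"
  shows "conj_trace k W X A (B - B') = conj_trace k W X A B - conj_trace k W X A B'"
proof -
  have Y: "mat_adjoint (W * kron A (1\<^sub>m k) * X) \<in> carrier_mat (D * k) (D * k)"
    using X W kron_carrier[OF AB(1), of k] by auto
  show ?thesis
    using AB by (simp add: conj_trace_right[OF W X] minus_carrier_mat mat_trace_kron_minus[OF AB(2,3) Y])
qed

lemma conj_trace_mean_left:
  assumes W: "W \<in> carrier_mat (D * k) (D * k)" and X: "X \<in> carrier_mat (D * k) (D * k)"
    and AB: "\<And>l. l < n \<Longrightarrow> U l \<in> carrier_mat D D" "B \<in> carrier_mat D D"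
  shows "conj_trace k W X (mean_mat D n p U) B = (\<Sum>l<n. of_real (p l) * conj_trace k W X (U l) B)"
proof -
  have Y: "X * mat_adjoint (kron B (1\<^sub>m k)) * W \<in> carrier_mat (D * k) (D * k)"
    using X W kron_carrier[OF AB(2), of k] by auto
  show ?thesis
    using AB by (simp add: conj_trace_left[OF W X] mat_trace_kron_mean[OF AB(1) Y])
qed

lemma conj_trace_mean_right:
  assumes W: "W \<in> carrier_mat (D * k) (D * k)" and X: "X \<in> carrier_mat (D * k) (D * k)"
    and AB: "\<And>l. l < n \<Longrightarrow> U l \<in> carrier_mat D D" "A \<in> carrier_mat D D"
  shows "conj_trace k W X A (mean_mat D n p U) = (\<Sum>l<n. of_real (p l) * conj_trace k W X A (U l))"
proof -
  have Y: "mat_adjoint (W * kron A (1\<^sub>m k) * X) \<in> carrier_mat (D * k) (D * k)"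
    using X W kron_carrier[OF AB(2), of k] by auto
  show ?thesis
    using AB by (simp add: conj_trace_right[OF W X] mat_trace_kron_mean[OF AB(1) Y])
qed

text \<open>Cyclicity gathers everything except \<open>X\<close> into one matrix with operator bound
  \<open>b * (1 * a)\<close>, and Hoelder's inequality applies.\<close>

lemma conj_trace_le:
  assumes W: "W \<in> carrier_mat (D * k) (D * k)" and X: "X \<in> carrier_mat (D * k) (D * k)"
    and A: "A \<in> carrier_mat D D" and B: "B \<in> carrier_mat D D"
    and "op_bound a A" "op_bound b B" "op_bound 1 W" "0 \<le> a" "0 \<le> b"
  shows "cmod (conj_trace k W X A B) \<le> a * b * trace_norm X"
proof -
  note K = kron_carrier[OF A, of k]
  note L = mat_adjoint_carrier[OF kron_carrier[OF B, of k]]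
  let ?Z = "mat_adjoint (kron B (1\<^sub>m k)) * (W * kron A (1\<^sub>m k))"
  have WK: "W * kron A (1\<^sub>m k) \<in> carrier_mat (D * k) (D * k)" using W K by auto
  have Z: "?Z \<in> carrier_mat (D * k) (D * k)" using L WK by auto
  have KX: "kron A (1\<^sub>m k) * X \<in> carrier_mat (D * k) (D * k)" using X K by auto
  have "W * (kron A (1\<^sub>m k) * X * mat_adjoint (kron B (1\<^sub>m k))) =
      W * kron A (1\<^sub>m k) * X * mat_adjoint (kron B (1\<^sub>m k))"
    using assoc_mult_mat[OF W KX L] assoc_mult_mat[OF W K X] by simp
  hence "conj_trace k W X A B = mat_trace (mat_adjoint (kron B (1\<^sub>m k)) * (W * kron A (1\<^sub>m k) * X))"
    unfolding conj_trace_def using WK X L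
    by (simp only:) (rule mat_trace_mult_commute[OF mult_carrier_mat[OF WK X] L])
  also have "\<dots> = mat_trace (?Z * X)"
    using assoc_mult_mat[OF L WK X] by simp
  also have "op_bound (b * (1 * a)) ?Z"
    using assms op_bound_adjoint[OF kron_carrier[OF B] op_bound_kron[OF B]]
    by (intro op_bound_mult[OF L WK] op_bound_mult[OF W K] op_bound_kron[OF A]) auto
  hence "cmod (mat_trace (?Z * X)) \<le> b * (1 * a) * trace_norm X"
    by (rule norm_trace_mult_le[OF Z X]) (use assms in auto)
  finally show ?thesis by (simp add: mult_ac)
qed

text \<open>Expand each conjugation by \<open>U l\<close> around \<open>V\<close>. After averaging,
  the first-order terms see only the deviation of the mean from \<open>V\<close>, once on each side,
  giving \<open>2 * m\<close>; the second-order terms have both sides within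
  \<open>\<delta>\<close>, giving \<open>\<delta>\<^sup>2\<close>.\<close>

lemma trace_norm_tensor_mixed_le:
  assumes V: "unitary_mat D V" and U: "\<And>l. l < n \<Longrightarrow> U l \<in> carrier_mat D D"
    and p: "\<And>l. l < n \<Longrightarrow> 0 \<le> p l" "(\<Sum>l<n. p l) = 1"
    and near: "\<And>l. l < n \<Longrightarrow> op_bound \<delta> (U l - V)" and \<delta>: "0 \<le> \<delta>"
    and mean: "op_bound m (mean_mat D n p U - V)" and m: "0 \<le> m"
    and X: "X \<in> carrier_mat (D * k) (D * k)"
  shows "trace_norm (tensor_id D k (\<lambda>\<rho>. mixed_unitary_channel D n p U \<rho> - unitary_channel V \<rho>) X)
    \<le> (2 * m + \<delta>\<^sup>2) * trace_norm X"
proof -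
  let ?T = "tensor_id D k (\<lambda>\<rho>. mixed_unitary_channel D n p U \<rho> - unitary_channel V \<rho>) X"
  let ?Q = "\<lambda>A. kron A (1\<^sub>m k) * X * mat_adjoint (kron A (1\<^sub>m k))"
  note Vc = unitary_matD(1)[OF V]
  have T: "?T \<in> carrier_mat (D * k) (D * k)" by (simp add: tensor_id_def)
  have Q: "?Q A \<in> carrier_mat (D * k) (D * k)" if "A \<in> carrier_mat D D" for A
    using X kron_carrier[OF that, of k] by auto
  obtain W where W: "W \<in> carrier_mat (D * k) (D * k)" and bW: "op_bound 1 W"
    and tr: "mat_trace (W * ?T) = of_real (trace_norm ?T)"
    using trace_norm_attained[OF T] .
  note minus_left = conj_trace_minus_left[OF W X]
  note minus_right = conj_trace_minus_right[OF W X]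
  let ?F = "conj_trace k W X"
  let ?N = "mean_mat D n p U"
  have T_index: "?T $$ (r, s) = (\<Sum>l<n. of_real (p l) * ?Q (U l) $$ (r, s)) - ?Q V $$ (r, s)"
    if rs: "r < D * k" "s < D * k" for r s
  proof -
    have div: "r div k < D" "s div k < D" using rs by (simp_all add: less_mult_imp_div_less)
    have ch: "unitary_channel A M \<in> carrier_mat D D"
      if "A \<in> carrier_mat D D" "M \<in> carrier_mat D D" for A M
      using that by (auto simp: unitary_channel_def)
    have B: "aux_block D k X (r mod k) (s mod k) \<in> carrier_mat D D" by (simp add: aux_block_def)
    have mixed: "mixed_unitary_channel D n p U \<rho> =
        mat D D (\<lambda>(i, j). \<Sum>l<n. (complex_of_real (p l) \<cdot>\<^sub>m unitary_channel (U l) \<rho>) $$ (i, j))" for \<rho>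
      by (simp add: mixed_unitary_channel_def unitary_channel_def)
    have "?T $$ (r, s) = (\<Sum>l<n. (complex_of_real (p l) \<cdot>\<^sub>m
        unitary_channel (U l) (aux_block D k X (r mod k) (s mod k))) $$ (r div k, s div k)) -
        unitary_channel V (aux_block D k X (r mod k) (s mod k)) $$ (r div k, s div k)"
      using rs div carrier_matD[OF ch[OF Vc B]] by (simp add: tensor_id_def mixed)
    also have "\<dots> = (\<Sum>l<n. of_real (p l) * ?Q (U l) $$ (r, s)) - ?Q V $$ (r, s)"
      unfolding kron_conjugation_index[OF Vc X rs]
      using div carrier_matD[OF ch[OF U B]]
      by (intro arg_cong2[of _ _ _ _ minus] sum.cong refl)
        (simp add: kron_conjugation_index[OF U X rs] del: index_mult_mat(1))
    finally show ?thesis .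
  qed
  have "mat_trace (W * ?T) = (\<Sum>r<D * k. \<Sum>t<D * k.
      (\<Sum>l<n. of_real (p l) * (W $$ (r, t) * ?Q (U l) $$ (t, r))) - W $$ (r, t) * ?Q V $$ (t, r))"
    unfolding mat_trace_mult[OF W T]
    by (intro sum.cong refl) (simp add: T_index right_diff_distrib sum_distrib_left mult_ac
        del: index_mult_mat(1))
  also have "\<dots> = (\<Sum>r<D * k. \<Sum>t<D * k. \<Sum>l<n. of_real (p l) * (W $$ (r, t) * ?Q (U l) $$ (t, r)))
      - ?F V V"
    unfolding conj_trace_def mat_trace_mult[OF W Q[OF Vc]] by (simp add: sum_subtractf del: index_mult_mat(1))
  also have "(\<Sum>r<D * k. \<Sum>t<D * k. \<Sum>l<n. of_real (p l) * (W $$ (r, t) * ?Q (U l) $$ (t, r))) =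
      (\<Sum>r<D * k. \<Sum>l<n. \<Sum>t<D * k. of_real (p l) * (W $$ (r, t) * ?Q (U l) $$ (t, r)))"
    by (intro sum.cong refl sum.swap)
  also have "\<dots> = (\<Sum>l<n. \<Sum>r<D * k. \<Sum>t<D * k. of_real (p l) * (W $$ (r, t) * ?Q (U l) $$ (t, r)))"
    by (rule sum.swap)
  also have "\<dots> = (\<Sum>l<n. of_real (p l) * ?F (U l) (U l))"
    unfolding conj_trace_def
    by (intro sum.cong refl) (simp add: mat_trace_mult[OF W Q[OF U]] sum_distrib_left del: index_mult_mat(1))
  \<comment> \<open>Sesquilinear expansion of \<open>?F (U l - V) (U l - V)\<close>, solved for
    \<open>?F (U l) (U l)\<close>.\<close>
  also have "\<dots> = (\<Sum>l<n. of_real (p l) * ?F (U l) V) + (\<Sum>l<n. of_real (p l) * ?F V (U l))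
      - (\<Sum>l<n. of_real (p l)) * ?F V V + (\<Sum>l<n. of_real (p l) * ?F (U l - V) (U l - V))"
    unfolding sum_distrib_right sum.distrib[symmetric] sum_subtractf[symmetric]
  proof (intro sum.cong refl)
    fix l assume "l \<in> {..<n}"
    hence Ul: "U l \<in> carrier_mat D D" using U by simp
    show "of_real (p l) * ?F (U l) (U l) = of_real (p l) * ?F (U l) V + of_real (p l) * ?F V (U l)
        - of_real (p l) * ?F V V + of_real (p l) * ?F (U l - V) (U l - V)"
      unfolding minus_left[OF Ul Vc minus_carrier_mat[OF Vc]]
        minus_right[OF Ul Ul Vc] minus_right[OF Vc Ul Vc]
      by (simp add: algebra_simps)
  qed
  also have "(\<Sum>l<n. complex_of_real (p l)) = 1"
    using p(2) by (metis of_real_1 of_real_sum)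
  also have "(\<Sum>l<n. of_real (p l) * ?F (U l) V) = ?F ?N V"
    by (rule conj_trace_mean_left[OF W X U Vc, symmetric])
  also have "(\<Sum>l<n. of_real (p l) * ?F V (U l)) = ?F V ?N"
    by (rule conj_trace_mean_right[OF W X U Vc, symmetric])
  \<comment> \<open>One \<open>?F V V\<close> comes from the expansion and one from the target
    channel; each completes one first-order term to a difference \<open>?N - V\<close>.\<close>
  also have "?F ?N V + ?F V ?N - 1 * ?F V V + (\<Sum>l<n. of_real (p l) * ?F (U l - V) (U l - V)) - ?F V V
    = ?F (?N - V) V + ?F V (?N - V) + (\<Sum>l<n. of_real (p l) * ?F (U l - V) (U l - V))"
    unfolding minus_left[OF mean_mat_carrier Vc Vc] minus_right[OF Vc mean_mat_carrier Vc] by simp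
  finally have eq: "complex_of_real (trace_norm ?T) =
    ?F (?N - V) V + ?F V (?N - V) + (\<Sum>l<n. of_real (p l) * ?F (U l - V) (U l - V))"
    unfolding tr .
  have "trace_norm ?T \<le> cmod (complex_of_real (trace_norm ?T))"
    unfolding norm_of_real by (rule abs_ge_self)
  also have "\<dots> \<le> m * 1 * trace_norm X + 1 * m * trace_norm X + (\<Sum>l<n. p l * (\<delta> * \<delta> * trace_norm X))"
    unfolding eq
  proof (intro norm_triangle_mono sum_norm_le)
    show "cmod (?F (?N - V) V) \<le> m * 1 * trace_norm X"
      by (rule conj_trace_le[OF W X minus_carrier_mat[OF Vc] Vc mean op_bound_unitary[OF V] bW m]) simp
    show "cmod (?F V (?N - V)) \<le> 1 * m * trace_norm X"
      by (rule conj_trace_le[OF W X Vc minus_carrier_mat[OF Vc] op_bound_unitary[OF V] mean bW _ m]) simp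
    fix l assume "l \<in> {..<n}"
    hence l: "l < n" by simp
    have "cmod (?F (U l - V) (U l - V)) \<le> \<delta> * \<delta> * trace_norm X"
      by (rule conj_trace_le[OF W X minus_carrier_mat[OF Vc] minus_carrier_mat[OF Vc]
            near[OF l] near[OF l] bW \<delta> \<delta>])
    thus "cmod (of_real (p l) * ?F (U l - V) (U l - V)) \<le> p l * (\<delta> * \<delta> * trace_norm X)"
      using p(1)[OF l] by (simp add: norm_mult mult_left_mono)
  qed
  also have "\<dots> = (2 * m + \<delta>\<^sup>2) * trace_norm X"
    unfolding sum_distrib_right[symmetric] p(2) by (simp add: algebra_simps power2_eq_square)
  finally show ?thesis .
qed

text \<open>Makes the zero matrix an admissible input, so that the set under the diamond supremum is
  nonempty.\<close>

lemma trace_norm_zero: "trace_norm (0\<^sub>m n n) = 0"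
proof -
  have Z: "0\<^sub>m n n \<in> carrier_mat n n" by simp
  obtain W where W: "W \<in> carrier_mat n n"
    and "mat_trace (W * 0\<^sub>m n n) = of_real (trace_norm (0\<^sub>m n n))"
    using trace_norm_attained[OF Z] .
  moreover have "mat_trace (W * 0\<^sub>m n n) = 0"
    using W by (simp add: mat_trace_def)
  ultimately show ?thesis by simp
qed

text \<open>The preceding estimate is independent of \<open>k\<close>, so it bounds the supremum;
  the factor 1/2 in the distance halves both terms.\<close>

theorem diamond_dist_mixed_unitary_le:
  assumes V: "unitary_mat D V" and U: "\<And>l. l < n \<Longrightarrow> U l \<in> carrier_mat D D"
    and p: "\<And>l. l < n \<Longrightarrow> 0 \<le> p l" "(\<Sum>l<n. p l) = 1"
    and near: "\<And>l. l < n \<Longrightarrow> op_bound \<delta> (U l - V)" and \<delta>: "0 \<le> \<delta>"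
    and mean: "op_bound m (mean_mat D n p U - V)" and m: "0 \<le> m"
  shows "diamond_dist D (mixed_unitary_channel D n p U) (unitary_channel V) \<le> m + \<delta>\<^sup>2 / 2"
proof -
  let ?E = "\<lambda>\<rho>. mixed_unitary_channel D n p U \<rho> - unitary_channel V \<rho>"
  have "diamond_norm D ?E \<le> 2 * m + \<delta>\<^sup>2"
    unfolding diamond_norm_def
  proof (rule cSup_least)
    have "trace_norm (tensor_id D 1 ?E (0\<^sub>m (D * 1) (D * 1))) \<in> {trace_norm (tensor_id D k ?E X) | k X.
        1 \<le> k \<and> X \<in> carrier_mat (D * k) (D * k) \<and> trace_norm X \<le> 1}"
      using trace_norm_zero[of "D * 1"] zero_carrier_mat[of "D * 1" "D * 1"] by fastforce
    thus "{trace_norm (tensor_id D k ?E X) | k X.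
        1 \<le> k \<and> X \<in> carrier_mat (D * k) (D * k) \<and> trace_norm X \<le> 1} \<noteq> {}" by blast
    fix x assume "x \<in> {trace_norm (tensor_id D k ?E X) | k X.
        1 \<le> k \<and> X \<in> carrier_mat (D * k) (D * k) \<and> trace_norm X \<le> 1}"
    then obtain k X where x: "x = trace_norm (tensor_id D k ?E X)"
      and X: "X \<in> carrier_mat (D * k) (D * k)" "trace_norm X \<le> 1" by blast
    have "x \<le> (2 * m + \<delta>\<^sup>2) * trace_norm X"
      unfolding x by (rule trace_norm_tensor_mixed_le[OF V U p near \<delta> mean m X(1)])
    also have "\<dots> \<le> (2 * m + \<delta>\<^sup>2) * 1"
      using X(2) m by (intro mult_left_mono) auto
    finally show "x \<le> 2 * m + \<delta>\<^sup>2" by simp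
  qed
  thus ?thesis by (simp add: diamond_dist_def field_simps)
qed

section \<open>Mixtures with a telescoping mean\<close>

text \<open>Writing \<open>U\<^sub>l - V = (V g\<^sub>l\<^sub>+\<^sub>1 - V g\<^sub>l) + V (g\<^sub>l\<^sup>\<dagger> - 1) (g\<^sub>l\<^sub>+\<^sub>1 - g\<^sub>l)\<close>, the first-order part telescopes
  in the average and the remainder is quadratic in \<open>\<epsilon>\<close>.\<close>

lemma op_bound_telescoping_mean:
  assumes V: "unitary_mat D V" and g: "\<And>l. unitary_mat D (g l)"
    and near: "\<And>l. op_bound \<epsilon> (g l - 1\<^sub>m D)" and \<epsilon>: "0 \<le> \<epsilon>" and n: "0 < n"
  defines "U l \<equiv> V * mat_adjoint (g l) * g (Suc l)"
  shows "op_bound (2 * \<epsilon>) (U l - V)"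
    and "op_bound (2 * \<epsilon> / n + 2 * \<epsilon>\<^sup>2) (mean_mat D n (\<lambda>_. 1 / n) U - V)"
proof -
  note Vc = unitary_matD(1)[OF V] and gc = unitary_matD(1)[OF g]
  note g'c = mat_adjoint_carrier[OF gc]
  have one: "1\<^sub>m D \<in> carrier_mat D D" by simp
  let ?d = "\<lambda>l. g (Suc l) - g l"
  define R where "R l = V * ((mat_adjoint (g l) - 1\<^sub>m D) * ?d l)" for l
  have dc: "?d l \<in> carrier_mat D D" for l using gc by (rule minus_carrier_mat)
  have hc: "mat_adjoint (g l) - 1\<^sub>m D \<in> carrier_mat D D" for l by (rule minus_carrier_mat[OF one])
  have hdc: "(mat_adjoint (g l) - 1\<^sub>m D) * ?d l \<in> carrier_mat D D" for l
    using hc dc by (rule mult_carrier_mat)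
  have Rc: "R l \<in> carrier_mat D D" for l unfolding R_def using Vc hdc by (rule mult_carrier_mat)
  have Uc: "U l \<in> carrier_mat D D" for l
    unfolding U_def by (intro mult_carrier_mat[of _ D D] Vc gc g'c)
  have Vgc: "V * g l \<in> carrier_mat D D" for l using Vc gc by (rule mult_carrier_mat)

  \<comment> \<open>Consecutive errors are compared through the identity, from which each is within
    \<epsilon>.\<close>
  have bd: "op_bound (2 * \<epsilon>) (?d l)" for l
  proof -
    have "?d l = (g (Suc l) - 1\<^sub>m D) + (1\<^sub>m D - g l)"
      using gc[of l] gc[of "Suc l"] by (intro eq_matI) auto
    thus ?thesis
      using op_bound_add[OF minus_carrier_mat[OF one] minus_carrier_mat[OF gc] near
          op_bound_minus_commute[OF gc one near], of "Suc l" l]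
      by simp
  qed
  have bh: "op_bound \<epsilon> (mat_adjoint (g l) - 1\<^sub>m D)" for l
    using op_bound_adjoint[OF minus_carrier_mat[OF one] near \<epsilon>, of l]
    by (simp add: mat_adjoint_minus[OF gc one])
  \<comment> \<open>The two small factors have sizes \<epsilon> and 2 \<epsilon>; the unitary
    \<open>V\<close> costs nothing.\<close>
  have bR: "op_bound (2 * \<epsilon>\<^sup>2) (R l)" for l
    using op_bound_mult[OF Vc hdc op_bound_unitary[OF V] op_bound_mult[OF hc dc bh bd \<epsilon>]]
    by (simp add: R_def power2_eq_square mult_ac)

  \<comment> \<open>Insert \<open>mat_adjoint (g l) * g l\<close>, which is the identity, behind
    \<open>V\<close>.\<close>
  have UV: "U l - V = V * (mat_adjoint (g l) * ?d l)" for l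
  proof -
    have "V * (mat_adjoint (g l) * ?d l) = V * (mat_adjoint (g l) * g (Suc l)) - V * 1\<^sub>m D"
      unfolding mult_minus_distrib_mat[OF g'c gc gc] unitary_matD(2)[OF g]
      by (intro mult_minus_distrib_mat[OF Vc mult_carrier_mat[OF g'c gc] one])
    thus ?thesis
      using assoc_mult_mat[OF Vc g'c gc] right_mult_one_mat[OF Vc] by (simp add: U_def)
  qed
  show "op_bound (2 * \<epsilon>) (U l - V)"
    unfolding UV
    using op_bound_mult[OF Vc mult_carrier_mat[OF g'c dc] op_bound_unitary[OF V]
        op_bound_mult[OF g'c dc op_bound_unitary[OF unitary_mat_adjoint[OF g]] bd]]
    by simp
  have UV_split: "U l - V = (V * g (Suc l) - V * g l) + R l" for l
  proof -
    have "R l = V * (mat_adjoint (g l) * ?d l) - V * ?d l"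
      unfolding R_def minus_mult_distrib_mat[OF g'c one dc] left_mult_one_mat[OF dc]
      by (rule mult_minus_distrib_mat[OF Vc mult_carrier_mat[OF g'c dc] dc])
    hence R_eq: "R l = (U l - V) - (V * g (Suc l) - V * g l)"
      unfolding UV mult_minus_distrib_mat[OF Vc gc gc] .
    show ?thesis
      unfolding R_eq using Uc[of l] Vc Vgc[of l] Vgc[of "Suc l"]
      by (intro eq_matI) (auto simp del: index_mult_mat(1))
  qed

  \<comment> \<open>Only the two end terms of the telescoping sum survive, divided by
    \<open>n\<close>; the remainders are averaged.\<close>
  have "mean_mat D n (\<lambda>_. 1 / n) U - V =
      complex_of_real (1 / n) \<cdot>\<^sub>m (V * (g n - g 0)) + mean_mat D n (\<lambda>_. 1 / n) R"
  proof (rule eq_matI)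
    fix i j assume "i < dim_row (complex_of_real (1 / n) \<cdot>\<^sub>m (V * (g n - g 0)) + mean_mat D n (\<lambda>_. 1 / n) R)"
      "j < dim_col (complex_of_real (1 / n) \<cdot>\<^sub>m (V * (g n - g 0)) + mean_mat D n (\<lambda>_. 1 / n) R)"
    hence ij: "i < D" "j < D" by (auto simp: mean_mat_def)
    have U_entry: "U l $$ (i, j) = V $$ (i, j) + ((V * g (Suc l)) $$ (i, j) - (V * g l) $$ (i, j)) + R l $$ (i, j)" for l
    proof -
      have "U l $$ (i, j) - V $$ (i, j) = (U l - V) $$ (i, j)"
        using ij Vc by simp
      also have "\<dots> = ((V * g (Suc l)) $$ (i, j) - (V * g l) $$ (i, j)) + R l $$ (i, j)"
        unfolding UV_split using ij carrier_matD[OF Vgc[of l]] carrier_matD[OF Rc[of l]]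
        by (simp del: index_mult_mat(1))
      finally show ?thesis by (simp add: algebra_simps del: index_mult_mat(1))
    qed
    have "(\<Sum>l<n. U l $$ (i, j)) =
        of_nat n * V $$ (i, j) + ((V * g n) $$ (i, j) - (V * g 0) $$ (i, j)) + (\<Sum>l<n. R l $$ (i, j))"
      unfolding U_entry sum.distrib sum_lessThan_telescope[of "\<lambda>l. (V * g l) $$ (i, j)"] by simp
    hence "(\<Sum>l<n. U l $$ (i, j)) / of_nat n - V $$ (i, j) =
        ((V * g n) $$ (i, j) - (V * g 0) $$ (i, j)) / of_nat n + (\<Sum>l<n. R l $$ (i, j)) / of_nat n"
      using n by (simp add: field_simps)
    moreover have "mean_mat D n (\<lambda>_. 1 / n) S $$ (i, j) = (\<Sum>l<n. S l $$ (i, j)) / of_nat n" for S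
      using ij by (simp add: mean_mat_def sum_divide_distrib)
    ultimately show "(mean_mat D n (\<lambda>_. 1 / n) U - V) $$ (i, j) =
        (complex_of_real (1 / n) \<cdot>\<^sub>m (V * (g n - g 0)) + mean_mat D n (\<lambda>_. 1 / n) R) $$ (i, j)"
      unfolding mult_minus_distrib_mat[OF Vc gc gc]
      using ij Vc Vgc[of n] Vgc[of 0] carrier_matD[OF mean_mat_carrier[of D n "\<lambda>_. 1 / n" R]]
      by (auto simp del: index_mult_mat(1))
  qed (use Vc gc in \<open>auto simp: mean_mat_def\<close>)
  moreover have "op_bound (1 / n * (2 * \<epsilon>)) (complex_of_real (1 / n) \<cdot>\<^sub>m (V * (g n - g 0)))"
  proof -
    have gd: "g n - g 0 \<in> carrier_mat D D" using gc by (rule minus_carrier_mat)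
    have "g n - g 0 = (g n - 1\<^sub>m D) + (1\<^sub>m D - g 0)"
      using gc[of n] gc[of 0] by (intro eq_matI) auto
    hence "op_bound (2 * \<epsilon>) (g n - g 0)"
      using op_bound_add[OF minus_carrier_mat[OF one] minus_carrier_mat[OF gc] near
          op_bound_minus_commute[OF gc one near], of n 0]
      by simp
    from op_bound_mult[OF Vc gd op_bound_unitary[OF V] this]
    have "op_bound (2 * \<epsilon>) (V * (g n - g 0))" by simp
    from op_bound_smult[OF mult_carrier_mat[OF Vc gd] this, of "complex_of_real (1 / n)"]
    show ?thesis by (simp add: norm_divide)
  qed
  moreover have "op_bound (2 * \<epsilon>\<^sup>2) (mean_mat D n (\<lambda>_. 1 / n) R)"
    using op_bound_mean_mat[of n R D "2 * \<epsilon>\<^sup>2" "\<lambda>_. 1 / n"] Rc bR n by simp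
  ultimately show "op_bound (2 * \<epsilon> / n + 2 * \<epsilon>\<^sup>2) (mean_mat D n (\<lambda>_. 1 / n) U - V)"
    using op_bound_add[of "complex_of_real (1 / n) \<cdot>\<^sub>m (V * (g n - g 0))" D D
        "mean_mat D n (\<lambda>_. 1 / n) R" "1 / n * (2 * \<epsilon>)" "2 * \<epsilon>\<^sup>2"] Vc gc
    by (simp add: minus_carrier_mat)
qed

section \<open>Closure properties that keep the corrected targets inside the group\<close>

lemma lie_subgroup_SU_closed:
  assumes L: "lie_subgroup_SU d D L"
  shows "x \<in> L \<Longrightarrow> unitary_mat D x"
    and "x \<in> L \<Longrightarrow> y \<in> L \<Longrightarrow> x * y \<in> L"
    and "x \<in> L \<Longrightarrow> mat_adjoint x \<in> L"
proof -
  let ?G = "(special_unitary_group D)\<lparr>carrier := L\<rparr>"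
  have sub: "subgroup L (special_unitary_group D)" and "group ?G"
    using L by (auto simp: lie_subgroup_SU_def lie_group_def)
  then interpret G: group ?G by simp
  have unit: "unitary_mat D x" if "x \<in> L" for x
    using subgroup.subset[OF sub] that
    by (auto simp: special_unitary_group_def unitary_group_def unitary_mat_def)
  show "x \<in> L \<Longrightarrow> unitary_mat D x" by (rule unit)
  show "x \<in> L \<Longrightarrow> y \<in> L \<Longrightarrow> x * y \<in> L"
    using G.m_closed[of x y] by (simp add: special_unitary_group_def unitary_group_def)
  assume x: "x \<in> L"
  then obtain y where y: "y \<in> L" "y * x = 1\<^sub>m D"
    using G.l_inv_ex[of x] by (auto simp: special_unitary_group_def unitary_group_def)
  note c = unitary_matD(1)[OF unit[OF x]] unitary_matD(1)[OF unit[OF y(1)]]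
  \<comment> \<open>Uniqueness of inverses: the group inverse \<open>y\<close> in \<open>L\<close>
    coincides with the adjoint.\<close>
  have "mat_adjoint x = y * x * mat_adjoint x" using y(2) c by simp
  also have "\<dots> = y * (x * mat_adjoint x)"
    by (rule assoc_mult_mat[OF c(2,1) mat_adjoint_carrier[OF c(1)]])
  also have "\<dots> = y" using unitary_matD(3)[OF unit[OF x]] c by simp
  finally show "mat_adjoint x \<in> L" using y(1) by simp
qed

section \<open>Choice of the targets and assembly of the constants\<close>

theorem theorem1:
  fixes D d :: nat
    and L \<G> :: "complex mat set"
    and cost :: "complex mat \<Rightarrow> real"
    and f :: "real \<Rightarrow> real"
  assumes "D \<ge> 1"
    and "lie_subgroup_SU d D L"
    and "finite \<G>" and "\<G> \<subseteq> carrier (unitary_group D)"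
    and "\<And>W. W \<in> \<G> \<Longrightarrow> 0 \<le> cost W"
    and "generate (unitary_group D) \<G> \<subseteq> L"
    and dense: "\<And>V \<delta>. V \<in> L \<Longrightarrow> \<delta> > 0 \<Longrightarrow>
           \<exists>U \<in> generate (unitary_group D) \<G>. op_norm (U - V) < \<delta>"
    and synthesis: "\<And>V \<epsilon>. V \<in> L \<Longrightarrow> \<epsilon> > 0 \<Longrightarrow>
           \<exists>Ws U. set Ws \<subseteq> \<G> \<and> U = gate_product D Ws \<and> U \<in> generate (unitary_group D) \<G> \<and>
             op_norm (U - V) \<le> \<epsilon> \<and> (\<Sum>W\<leftarrow>Ws. cost W) \<le> f \<epsilon>"
  shows "\<forall>V\<in>L. \<forall>\<epsilon>. 0 < \<epsilon> \<and> \<epsilon> < 0.01 \<longrightarrow>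
           (\<exists>(n::nat) U p.
              (\<forall>j<n. U j \<in> generate (unitary_group D) \<G> \<and> cost_at_most D \<G> cost (U j) (f \<epsilon>)) \<and>
              (\<forall>j<n. 0 \<le> p j) \<and> (\<Sum>j<n. p j) = 1 \<and>
              diamond_dist D (mixed_unitary_channel D n p U) (unitary_channel V) \<le> 10 * \<epsilon>\<^sup>2)"
proof (intro ballI allI impI)
  fix V :: "complex mat" and \<epsilon> :: real
  assume VL: "V \<in> L" and "0 < \<epsilon> \<and> \<epsilon> < 0.01"
  hence \<epsilon>: "0 < \<epsilon>" by simp
  note L = lie_subgroup_SU_closed[OF assms(2)]
  let ?gen = "generate (unitary_group D) \<G>"
  \<comment> \<open>Every target is synthesised at the same accuracy \<epsilon>, so all words share
    the cost bound \<open>f \<epsilon>\<close>.\<close>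
  have "\<forall>W\<in>L. \<exists>U. U \<in> ?gen \<and> cost_at_most D \<G> cost U (f \<epsilon>) \<and> op_norm (U - W) \<le> \<epsilon>"
    using synthesis[OF _ \<epsilon>] unfolding cost_at_most_def by metis
  then obtain \<phi> where \<phi>: "\<And>W. W \<in> L \<Longrightarrow> \<phi> W \<in> ?gen" "\<And>W. W \<in> L \<Longrightarrow> cost_at_most D \<G> cost (\<phi> W) (f \<epsilon>)"
    "\<And>W. W \<in> L \<Longrightarrow> op_norm (\<phi> W - W) \<le> \<epsilon>"
    unfolding Bex_def by metis
  have \<phi>L: "\<phi> W \<in> L" if "W \<in> L" for W using \<phi>(1)[OF that] assms(6) by blast
  \<comment> \<open>The factor after \<open>V\<close> is the adjoint of the error \<open>g l\<close>
    defined below, so each target undoes the error made at the previous one.\<close>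
  define v where "v = rec_nat V (\<lambda>_ W. V * (mat_adjoint (\<phi> W) * W))"
  have vL: "v l \<in> L" for l
    by (induction l) (auto simp: v_def VL intro!: L(2,3) \<phi>L)
  define g where "g l = mat_adjoint (v l) * \<phi> (v l)" for l
  note V = L(1)[OF VL]
  have vu: "unitary_mat D (v l)" and \<phi>u: "unitary_mat D (\<phi> (v l))" for l
    using L(1)[OF vL] L(1)[OF \<phi>L[OF vL]] .
  note vc = unitary_matD(1)[OF vu] and \<phi>c = unitary_matD(1)[OF \<phi>u]
  have g: "unitary_mat D (g l)" for l
    unfolding g_def by (intro unitary_mat_mult unitary_mat_adjoint vu \<phi>u)
  have near: "op_bound \<epsilon> (g l - 1\<^sub>m D)" for l
  proof -
    \<comment> \<open>A unitary factor preserves the bound, so the relative error inherits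
      \<epsilon> from the synthesis guarantee.\<close>
    have "g l - 1\<^sub>m D = mat_adjoint (v l) * (\<phi> (v l) - v l)"
      unfolding mult_minus_distrib_mat[OF mat_adjoint_carrier[OF vc] \<phi>c vc] unitary_matD(2)[OF vu] g_def ..
    moreover have "op_bound \<epsilon> (\<phi> (v l) - v l)"
      using op_bound_op_norm[OF minus_carrier_mat[OF vc]] \<phi>(3)[OF vL] by (rule op_bound_mono)
    ultimately show ?thesis
      using op_bound_mult[OF mat_adjoint_carrier[OF vc] minus_carrier_mat[OF vc]
          op_bound_unitary[OF unitary_mat_adjoint[OF vu]], of \<epsilon> "\<phi> (v l)" l l] by simp
  qed
  have step: "\<phi> (v (Suc l)) = V * mat_adjoint (g l) * g (Suc l)" for l
  proof -
    have "v (Suc l) = V * mat_adjoint (g l)"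
      unfolding g_def mat_adjoint_mult[OF mat_adjoint_carrier[OF vc] \<phi>c] by (simp add: v_def)
    moreover have "v (Suc l) * g (Suc l) = \<phi> (v (Suc l))"
      unfolding g_def assoc_mult_mat[OF vc mat_adjoint_carrier[OF vc] \<phi>c, symmetric]
        unitary_matD(3)[OF vu] by (rule left_mult_one_mat[OF \<phi>c])
    ultimately show ?thesis by simp
  qed
  \<comment> \<open>Large enough for the boundary term \<open>2 * \<epsilon> / n\<close> to be at
    most \<open>2 * \<epsilon>\<^sup>2\<close>.\<close>
  obtain n :: nat where n: "1 / \<epsilon> < n" using reals_Archimedean2 by blast
  hence n0: "0 < n" using \<epsilon> by (cases n) (auto simp: field_simps)
  \<comment> \<open>The mixture starts at index 1: the word for the uncorrected target
    \<open>v 0 = V\<close> only supplies the first error \<open>g 0\<close>.\<close>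
  let ?U = "\<lambda>l. \<phi> (v (Suc l))" and ?p = "\<lambda>_::nat. 1 / real n"
  have "1 / real n \<le> \<epsilon>"
    using n \<epsilon> n0 by (simp add: field_simps)
  from mult_left_mono[OF this, of "2 * \<epsilon>"] have le: "2 * \<epsilon> / n + 2 * \<epsilon>\<^sup>2 \<le> 4 * \<epsilon>\<^sup>2"
    using \<epsilon> by (simp add: power2_eq_square)
  note telescoping = op_bound_telescoping_mean[OF V g near less_imp_le[OF \<epsilon>] n0]
  have mean: "op_bound (4 * \<epsilon>\<^sup>2) (mean_mat D n ?p ?U - V)"
    unfolding step by (rule op_bound_mono[OF telescoping(2) le])
  have close: "op_bound (2 * \<epsilon>) (?U l - V)" for l
    unfolding step by (rule telescoping(1))
  \<comment> \<open>The mean contributes \<open>4 * \<epsilon>\<^sup>2\<close> and the spread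
    \<open>\<delta> = 2 * \<epsilon>\<close> contributes
    \<open>2 * \<epsilon>\<^sup>2\<close>.\<close>
  have "diamond_dist D (mixed_unitary_channel D n ?p ?U) (unitary_channel V) \<le> 4 * \<epsilon>\<^sup>2 + (2 * \<epsilon>)\<^sup>2 / 2"
    by (rule diamond_dist_mixed_unitary_le[OF V \<phi>c _ _ close _ mean]) (use \<epsilon> n0 in auto)
  also have "\<dots> \<le> 10 * \<epsilon>\<^sup>2" by (simp add: power_mult_distrib)
  finally have "diamond_dist D (mixed_unitary_channel D n ?p ?U) (unitary_channel V) \<le> 10 * \<epsilon>\<^sup>2" .
  moreover have "\<forall>j<n. ?U j \<in> ?gen \<and> cost_at_most D \<G> cost (?U j) (f \<epsilon>)"
    using \<phi>(1,2)[OF vL] by blast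
  moreover have "(\<forall>j<n. 0 \<le> ?p j) \<and> (\<Sum>j<n. ?p j) = 1" using n0 by simp
  ultimately show "\<exists>(n::nat) U p.
              (\<forall>j<n. U j \<in> ?gen \<and> cost_at_most D \<G> cost (U j) (f \<epsilon>)) \<and>
              (\<forall>j<n. 0 \<le> p j) \<and> (\<Sum>j<n. p j) = 1 \<and>
              diamond_dist D (mixed_unitary_channel D n p U) (unitary_channel V) \<le> 10 * \<epsilon>\<^sup>2"
    by (intro exI[of _ n] exI[of _ ?U] exI[of _ ?p]) simp
qed

thm_deps theorem1

end
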